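(* Let $\mathcal{L}$ be an essentially finite $\mathrm{FOL}_{\cong}$-signature. If $\mathcal{S}$ is a derivable judgment of $LTT_{\mathcal{L}}$, then its interpretation $[\![\mathcal{S}]\!]$ is a derivable judgment of HoTT.
   Context: Logical symbols: $\cong_K$, $\rho_K$, $\tau_f$ (sorts) and $s_K,t_K,r_K,f_1,f_2,e_f$ (arrows). An $h$-signature is a FOLDS signature $\mathcal{L}$ (inverse category — skeletal, no non-identity endomorphisms, finitely many arrows out of each object — with a proper order: $K_f<K$ for non-identity $f\colon K\to K_f$, and $f<g$ when $\operatorname{cod}f<\operatorname{cod}g$; $K/\!/\mathcal{L}$ is the set of non-identity arrows out of $K$; top-level means non-identity and not a composite of two non-identity arrows) with $h\colon\mathrm{Ob}\,\mathcal{L}\to\mathbb{N}\cup\{\infty\}$ ($\infty-m=\infty$) such that: if $\cong_K\in\mathcal{L}$ then $h(K)\ge2$, the top-level arrows of $\cong_K$ are exactly $s_K,t_K\colon\cong_K\to K$, $gs_K=gt_K$ for $g$ out of $K$, $h(\cong_K)=h(K)-1$; if $\rho_K\in\mathcal{L}$ then $h(K)\ge2$, its only top-level arrow is $r_K\colon\rho_K\to\cong_K$, $s_Kr_K=t_Kr_K$, $h(\rho_K)=h(K)-2$; if $\tau_f\in\mathcal{L}$ then $f\colon A\to K$ is top-level for $A$, $h(K)\ge3$, the top-level arrows of $\tau_f$ are $e_f\colon\tau_f\to\cong_K$, $f_1,f_2\colon\tau_f\to A$, with $s_Ke_f=ff_1$, $t_Ke_f=ff_2$, $gf_1=gf_2$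 for $g\in A/\!/\mathcal{L}\setminus\{f\}$, $qff_1=qff_2$ for $q\in K/\!/\mathcal{L}$, $h(\tau_f)=h(A)-1$; only reflexivity sorts may have $h=0$. A $\mathrm{FOL}_{\cong}$-signature is an $h$-signature closed under adding $\cong_K,\rho_K$ for every sort $K$ with $h(K)\ge2$ and $\tau_f$ for every top-level $f\colon A\to K$ with $h(K)\ge2$. It is essentially finite if it has finitely many non-logical sorts. $LTT_{\mathcal{L}}$ is the FOLDS syntax of the underlying signature: sorts $A(x_f)_{f\in A/\!/\mathcal{L}}$; contexts $x_1:K_1,\dots$; judgments $\Gamma\ \mathbf{ok}$, $\Gamma\vdash K\ \mathbf{Sort}$, $\Gamma\vdash x:K$, $\Gamma\vdash\phi\ \mathbf{formula}$ generated by: empty context ok; extension by a fresh variable of a sort; weakening; variable axiom; for each sort $K$, from $\Gamma\vdash x_f:K_f(x_{pf})_{p}$ for all $f\in K/\!/\mathcal{L}$ infer $\Gamma\vdash K(x_f)_f\ \mathbf{Sort}$; formation of $\bot,\top,\wedge,\vee,\to,\forall x:K,\exists x:K$ formulas. HoTT: intensional MLTT with $\Pi,\Sigma,\mathrm{Id},\mathbf{1},\mathbf{0},+$, univalent universe $\mathcal{U}$ (decoding $\mathrm{El}$), propositional truncation $\|-\|$. $\mathrm{HStruc}(\mathcal{L})$ is the iterated $\Sigma$-type over the non-logical sorts $K$ of components $K:\Pi(f:\widehat{K_f})_{f\in K/\!/\mathcal{L}}\,\mathcal{U}^{h(K)}$ ($\mathcal{U}^m$ the types of $h$-level $m$, $\mathcal{U}^\infty=\mathcal{U}$;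 variables named by arrows; $\widehat{K_f}$ is $\mathrm{El}$ of the component $K_f$ applied to the variables $pf$ for non-logical $K_f$, and the identity type corresponding to the logical sort as in the interpretation below); it is a well-formed closed type. Interpretation $[\![-]\!]$: $[\![\varnothing]\!]=(\mathcal{M}:\mathrm{HStruc}(\mathcal{L}))$, $[\![\Gamma,x:K]\!]=[\![\Gamma]\!],x:[\![K]\!]$; for non-logical $K$, $[\![K(\mathbf{x})]\!]=\mathrm{El}(K^{\mathcal{M}}$ applied to $\mathbf{x})$ with $K^{\mathcal{M}}$ the $K$-th projection of $\mathcal{M}$; $[\![\cong_K(\mathbf{x})]\!]=\mathrm{Id}_{[\![K(x_{\mathbf{p}s})]\!]}(x_s,x_t)$; $[\![\rho_K(\mathbf{x})]\!]=\mathrm{Id}_{\mathrm{Id}_{[\![K(x_{\mathbf{p}sr})]\!]}(x_{sr},x_{tr})}(x_r,\mathrm{refl}_{x_{sr}})$; for $h\colon A\to K'$, $[\![\tau_h(\mathbf{x})]\!]=\mathrm{Id}_{[\![A(x_{\mathbf{p}h_2})]\!]}\big(x_{h_2},\mathrm{trans}^{\,v.[\![A(x_{\mathbf{p}h_1})]\!][v/x_{hh_1}]}_{x_{e_h}}(x_{h_1})\big)$; $[\![\bot]\!]=\mathbf{0}$, $[\![\top]\!]=\mathbf{1}$, $\wedge\mapsto\times$, $\vee\mapsto\|{-}+{-}\|$, $\to\mapsto\to$, $\exists x:K.\phi\mapsto\|\Sigma(x:[\![K]\!])[\![\phi]\!]\|$, $\forall x:K.\phi\mapsto\Pi(x:[\![K]\!])[\![\phi]\!]$;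 judgments: $\Gamma\ \mathbf{ok}\mapsto[\![\Gamma]\!]\ \mathbf{ok}$, $\Gamma\vdash K\ \mathbf{Sort}\mapsto[\![\Gamma]\!]\vdash[\![K]\!]\ \mathbf{Type}$, $\Gamma\vdash x:K\mapsto[\![\Gamma]\!]\vdash x:[\![K]\!]$, $\Gamma\vdash\phi\ \mathbf{formula}\mapsto[\![\Gamma]\!]\vdash[\![\phi]\!]\ \mathbf{Type}$.
   Formalization: In the clause for τ_h, [v/x_{hh₁}] replaces only the argument of A at position h, not other occurrences of that variable (else ill-typed); closure under τ_f is required only where an h-signature allows τ_f; sort formation also assumes Γ ok. *)

theory Defs
  imports Main "HOL-Library.Extended_Nat" "HOL-Library.FuncSet"
begin

section \<open>FOLDS signatures, h-signatures, FOL-with-isomorphism signatures\<close>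

text \<open>
  The tag of a sort records which symbol it is: \<^term>\<open>IsoSym K\<close> is the symbol written
  cong with index K, \<^term>\<open>ReflSym K\<close> is rho with index K, and \<^term>\<open>TransSym f\<close> is tau
  with index f.
\<close>

datatype ('o, 'a) sort_tag = NonLogical | IsoSym 'o | ReflSym 'o | TransSym 'a

text \<open>
  \<^term>\<open>Arr\<close> contains the identities, and \<open>Cmp L g f\<close> is the composite ``g after f''.
  \<open>oless\<close> and \<open>aless\<close> are the strict proper orders on sorts and on arrows.  The last fields
  name the arrows \<open>s\<^sub>K\<close>, \<open>t\<^sub>K\<close>, \<open>r\<^sub>K\<close>, \<open>f\<^sub>1\<close>, \<open>f\<^sub>2\<close>, \<open>e\<^sub>f\<close>; their values
  are irrelevant when the corresponding logical sort does not occur.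
\<close>

record ('o, 'a) signature =
  Ob :: "'o set"
  Arr :: "'a set"
  Dom :: "'a \<Rightarrow> 'o"
  Cod :: "'a \<Rightarrow> 'o"
  Idn :: "'o \<Rightarrow> 'a"
  Cmp :: "'a \<Rightarrow> 'a \<Rightarrow> 'a"
  oless :: "'o \<Rightarrow> 'o \<Rightarrow> bool"
  aless :: "'a \<Rightarrow> 'a \<Rightarrow> bool"
  tag :: "'o \<Rightarrow> ('o, 'a) sort_tag"
  hlev :: "'o \<Rightarrow> enat"
  s_arr :: "'o \<Rightarrow> 'a"
  t_arr :: "'o \<Rightarrow> 'a"
  r_arr :: "'o \<Rightarrow> 'a"
  arr1 :: "'a \<Rightarrow> 'a"
  arr2 :: "'a \<Rightarrow> 'a"
  e_arr :: "'a \<Rightarrow> 'a"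

definition is_arrow :: "('o, 'a) signature \<Rightarrow> 'a \<Rightarrow> 'o \<Rightarrow> 'o \<Rightarrow> bool" where
  "is_arrow L f A B \<longleftrightarrow> f \<in> Arr L \<and> Dom L f = A \<and> Cod L f = B"

definition category :: "('o, 'a) signature \<Rightarrow> bool" where
  "category L \<longleftrightarrow>
     (\<forall>f\<in>Arr L. Dom L f \<in> Ob L \<and> Cod L f \<in> Ob L) \<and>
     (\<forall>K\<in>Ob L. is_arrow L (Idn L K) K K) \<and>
     (\<forall>f\<in>Arr L. \<forall>g\<in>Arr L. Dom L g = Cod L f \<longrightarrow>
        is_arrow L (Cmp L g f) (Dom L f) (Cod L g)) \<and>
     (\<forall>f\<in>Arr L. Cmp L f (Idn L (Dom L f)) = f \<and> Cmp L (Idn L (Cod L f)) f = f) \<and>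
     (\<forall>f\<in>Arr L. \<forall>g\<in>Arr L. \<forall>k\<in>Arr L. Dom L g = Cod L f \<longrightarrow> Dom L k = Cod L g \<longrightarrow>
        Cmp L k (Cmp L g f) = Cmp L (Cmp L k g) f)"

definition inverse_category :: "('o, 'a) signature \<Rightarrow> bool" where
  "inverse_category L \<longleftrightarrow> category L \<and>
     (\<forall>A B f g. is_arrow L f A B \<and> is_arrow L g B A \<and>
        Cmp L g f = Idn L A \<and> Cmp L f g = Idn L B \<longrightarrow> A = B) \<and>
     (\<forall>K f. is_arrow L f K K \<longrightarrow> f = Idn L K) \<and>
     (\<forall>K\<in>Ob L. finite {f \<in> Arr L. Dom L f = K})"

text \<open>\<open>K // L\<close>.\<close>

definition out :: "('o, 'a) signature \<Rightarrow> 'o \<Rightarrow> 'a set" where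
  "out L K = {f \<in> Arr L. Dom L f = K \<and> f \<noteq> Idn L K}"

definition nonid :: "('o, 'a) signature \<Rightarrow> 'a \<Rightarrow> bool" where
  "nonid L f \<longleftrightarrow> f \<in> Arr L \<and> f \<noteq> Idn L (Dom L f)"

definition top_level :: "('o, 'a) signature \<Rightarrow> 'a \<Rightarrow> bool" where
  "top_level L f \<longleftrightarrow> nonid L f \<and>
     \<not> (\<exists>g k. nonid L g \<and> nonid L k \<and> Dom L g = Cod L k \<and> f = Cmp L g k)"

definition top_arrows :: "('o, 'a) signature \<Rightarrow> 'o \<Rightarrow> 'a set" where
  "top_arrows L K = {f. top_level L f \<and> Dom L f = K}"

definition strict_linear_on :: "'b set \<Rightarrow> ('b \<Rightarrow> 'b \<Rightarrow> bool) \<Rightarrow> bool" where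
  "strict_linear_on S lt \<longleftrightarrow>
     (\<forall>x\<in>S. \<not> lt x x) \<and>
     (\<forall>x\<in>S. \<forall>y\<in>S. \<forall>z\<in>S. lt x y \<longrightarrow> lt y z \<longrightarrow> lt x z) \<and>
     (\<forall>x\<in>S. \<forall>y\<in>S. x \<noteq> y \<longrightarrow> lt x y \<or> lt y x)"

text \<open>
  The proper order is part of the data of a signature and is linear, because contexts,
  argument lists, iterated products and iterated sums are laid out along it.
\<close>

definition proper_order :: "('o, 'a) signature \<Rightarrow> bool" where
  "proper_order L \<longleftrightarrow>
     strict_linear_on (Ob L) (oless L) \<and>
     (\<forall>K\<in>Ob L. \<forall>f\<in>out L K. oless L (Cod L f) K) \<and>
     (\<forall>K\<in>Ob L. strict_linear_on (out L K) (aless L)) \<and>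
     (\<forall>K\<in>Ob L. \<forall>f\<in>out L K. \<forall>g\<in>out L K. oless L (Cod L f) (Cod L g) \<longrightarrow> aless L f g)"

definition FOLDS_signature :: "('o, 'a) signature \<Rightarrow> bool" where
  "FOLDS_signature L \<longleftrightarrow> inverse_category L \<and> proper_order L"

definition has_symbol :: "('o, 'a) signature \<Rightarrow> ('o, 'a) sort_tag \<Rightarrow> bool" where
  "has_symbol L y \<longleftrightarrow> (\<exists>X\<in>Ob L. tag L X = y)"

definition iso_clause :: "('o, 'a) signature \<Rightarrow> 'o \<Rightarrow> 'o \<Rightarrow> bool" where
  "iso_clause L X K \<longleftrightarrow>
     K \<in> Ob L \<and> 2 \<le> hlev L K \<and>
     is_arrow L (s_arr L K) X K \<and> is_arrow L (t_arr L K) X K \<and>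
     s_arr L K \<noteq> t_arr L K \<and>
     top_arrows L X = {s_arr L K, t_arr L K} \<and>
     (\<forall>g\<in>out L K. Cmp L g (s_arr L K) = Cmp L g (t_arr L K)) \<and>
     hlev L X = hlev L K - 1"

definition refl_clause :: "('o, 'a) signature \<Rightarrow> 'o \<Rightarrow> 'o \<Rightarrow> bool" where
  "refl_clause L X K \<longleftrightarrow>
     K \<in> Ob L \<and> 2 \<le> hlev L K \<and>
     (\<exists>E\<in>Ob L. tag L E = IsoSym K \<and> is_arrow L (r_arr L K) X E) \<and>
     top_arrows L X = {r_arr L K} \<and>
     Cmp L (s_arr L K) (r_arr L K) = Cmp L (t_arr L K) (r_arr L K) \<and>
     hlev L X = hlev L K - 2"

definition trans_clause :: "('o, 'a) signature \<Rightarrow> 'o \<Rightarrow> 'a \<Rightarrow> bool" where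
  "trans_clause L X f \<longleftrightarrow> (let A = Dom L f; K = Cod L f; e = e_arr L f; f1 = arr1 L f; f2 = arr2 L f in
     top_level L f \<and> 3 \<le> hlev L K \<and>
     (\<exists>E\<in>Ob L. tag L E = IsoSym K \<and> is_arrow L e X E) \<and>
     is_arrow L f1 X A \<and> is_arrow L f2 X A \<and>
     distinct [e, f1, f2] \<and>
     top_arrows L X = {e, f1, f2} \<and>
     Cmp L (s_arr L K) e = Cmp L f f1 \<and>
     Cmp L (t_arr L K) e = Cmp L f f2 \<and>
     (\<forall>g\<in>out L A - {f}. Cmp L g f1 = Cmp L g f2) \<and>
     (\<forall>q\<in>out L K. Cmp L q (Cmp L f f1) = Cmp L q (Cmp L f f2)) \<and>
     hlev L X = hlev L A - 1)"

text \<open>The second conjunct says that a logical symbol names at most one sort.\<close>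

definition h_signature :: "('o, 'a) signature \<Rightarrow> bool" where
  "h_signature L \<longleftrightarrow> FOLDS_signature L \<and>
     (\<forall>X\<in>Ob L. \<forall>Y\<in>Ob L. tag L X = tag L Y \<longrightarrow> tag L X \<noteq> NonLogical \<longrightarrow> X = Y) \<and>
     (\<forall>X\<in>Ob L. \<forall>K. tag L X = IsoSym K \<longrightarrow> iso_clause L X K) \<and>
     (\<forall>X\<in>Ob L. \<forall>K. tag L X = ReflSym K \<longrightarrow> refl_clause L X K) \<and>
     (\<forall>X\<in>Ob L. \<forall>f. tag L X = TransSym f \<longrightarrow> trans_clause L X f) \<and>
     (\<forall>X\<in>Ob L. hlev L X = 0 \<longrightarrow> (\<exists>K. tag L X = ReflSym K))"

text \<open>
  Closure under transport sorts is required for those top-level \<open>f : A \<rightarrow> K\<close> with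
  \<open>h(K) \<ge> 2\<close> for which an h-signature may contain the sort at all: \<open>trans_clause\<close> demands
  \<open>h(K) \<ge> 3\<close>, and the sort would have level \<open>h(A) - 1\<close>, which must not be 0.  Without this
  proviso no sort of finite level \<open>\<ge> 2\<close> could occur (apply the condition to \<open>s\<^sub>K\<close> for
  \<open>h(K) = 2\<close>).  The condition without the proviso is stronger, see
  \<open>FOL_iso_signature_if_closed\<close>.
\<close>

definition trans_admissible :: "('o, 'a) signature \<Rightarrow> 'a \<Rightarrow> bool" where
  "trans_admissible L f \<longleftrightarrow> 3 \<le> hlev L (Cod L f) \<and> hlev L (Dom L f) - 1 \<noteq> 0"

definition FOL_iso_signature :: "('o, 'a) signature \<Rightarrow> bool" where
  "FOL_iso_signature L \<longleftrightarrow> h_signature L \<and>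
     (\<forall>K\<in>Ob L. 2 \<le> hlev L K \<longrightarrow> has_symbol L (IsoSym K) \<and> has_symbol L (ReflSym K)) \<and>
     (\<forall>f. top_level L f \<and> 2 \<le> hlev L (Cod L f) \<and> trans_admissible L f \<longrightarrow>
        has_symbol L (TransSym f))"

lemma FOL_iso_signature_if_closed:
  assumes "h_signature L"
    and "\<forall>K\<in>Ob L. 2 \<le> hlev L K \<longrightarrow> has_symbol L (IsoSym K) \<and> has_symbol L (ReflSym K)"
    and "\<forall>f. top_level L f \<and> 2 \<le> hlev L (Cod L f) \<longrightarrow> has_symbol L (TransSym f)"
  shows "FOL_iso_signature L"
  using assms by (auto simp: FOL_iso_signature_def)

definition nonlogical :: "('o, 'a) signature \<Rightarrow> 'o set" where
  "nonlogical L = {K \<in> Ob L. tag L K = NonLogical}"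

definition essentially_finite :: "('o, 'a) signature \<Rightarrow> bool" where
  "essentially_finite L \<longleftrightarrow> finite (nonlogical L)"

definition out_list :: "('o, 'a) signature \<Rightarrow> 'o \<Rightarrow> 'a list" where
  "out_list L K = (THE fs. sorted_wrt (aless L) fs \<and> distinct fs \<and> set fs = out L K)"

definition nonlogical_list :: "('o, 'a) signature \<Rightarrow> 'o list" where
  "nonlogical_list L = (THE Ks. sorted_wrt (oless L) Ks \<and> distinct Ks \<and> set Ks = nonlogical L)"


section \<open>The syntax \<open>LTT\<close> of a signature\<close>

type_synonym var = nat

text \<open>
  \<open>Sort K x\<close> is \<open>K(x\<^sub>f)\<close> with \<open>f\<close> ranging over \<open>K // L\<close>.  So that equal families give
  equal expressions, families are normalised outside \<open>K // L\<close> by \<open>sort_at\<close>.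
\<close>

datatype ('o, 'a) sort_exp = Sort 'o "'a \<Rightarrow> var"

definition sort_at :: "('o, 'a) signature \<Rightarrow> 'o \<Rightarrow> ('a \<Rightarrow> var) \<Rightarrow> ('o, 'a) sort_exp" where
  "sort_at L K x = Sort K (restrict x (out L K))"

datatype ('o, 'a) formula =
    Falsum
  | Verum
  | Conj "('o, 'a) formula" "('o, 'a) formula"
  | Disj "('o, 'a) formula" "('o, 'a) formula"
  | Impl "('o, 'a) formula" "('o, 'a) formula"
  | Forall var "('o, 'a) sort_exp" "('o, 'a) formula"
  | Exists var "('o, 'a) sort_exp" "('o, 'a) formula"

text \<open>Contexts, here and in the type theory below, have the most recent variable first.\<close>

type_synonym ('o, 'a) lctx = "(var \<times> ('o, 'a) sort_exp) list"

datatype ('o, 'a) lbody =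
    IsSort "('o, 'a) sort_exp"
  | HasSort var "('o, 'a) sort_exp"
  | IsFormula "('o, 'a) formula"

datatype ('o, 'a) ljudgement =
    LCtx "('o, 'a) lctx"
  | LEnt "('o, 'a) lctx" "('o, 'a) lbody"

inductive ltt :: "('o, 'a) signature \<Rightarrow> ('o, 'a) ljudgement \<Rightarrow> bool" for L where
  l_empty: "ltt L (LCtx [])"
| l_extend: "\<lbrakk>ltt L (LEnt \<Gamma> (IsSort S)); x \<notin> fst ` set \<Gamma>\<rbrakk> \<Longrightarrow> ltt L (LCtx ((x, S) # \<Gamma>))"
| l_weaken: "\<lbrakk>ltt L (LEnt (\<Delta> @ \<Gamma>) J); ltt L (LEnt \<Gamma> (IsSort S)); x \<notin> fst ` set (\<Delta> @ \<Gamma>)\<rbrakk>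
    \<Longrightarrow> ltt L (LEnt (\<Delta> @ (x, S) # \<Gamma>) J)"
| l_var: "ltt L (LCtx (\<Delta> @ (x, S) # \<Gamma>)) \<Longrightarrow> ltt L (LEnt (\<Delta> @ (x, S) # \<Gamma>) (HasSort x S))"
| l_sort: "\<lbrakk>K \<in> Ob L; ltt L (LCtx \<Gamma>);
     \<And>f. f \<in> out L K \<Longrightarrow>
       ltt L (LEnt \<Gamma> (HasSort (x f) (sort_at L (Cod L f) (\<lambda>p. x (Cmp L p f)))))\<rbrakk>
    \<Longrightarrow> ltt L (LEnt \<Gamma> (IsSort (sort_at L K x)))"
| l_falsum: "ltt L (LCtx \<Gamma>) \<Longrightarrow> ltt L (LEnt \<Gamma> (IsFormula Falsum))"
| l_verum: "ltt L (LCtx \<Gamma>) \<Longrightarrow> ltt L (LEnt \<Gamma> (IsFormula Verum))"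
| l_conj: "\<lbrakk>ltt L (LEnt \<Gamma> (IsFormula \<phi>)); ltt L (LEnt \<Gamma> (IsFormula \<psi>))\<rbrakk>
    \<Longrightarrow> ltt L (LEnt \<Gamma> (IsFormula (Conj \<phi> \<psi>)))"
| l_disj: "\<lbrakk>ltt L (LEnt \<Gamma> (IsFormula \<phi>)); ltt L (LEnt \<Gamma> (IsFormula \<psi>))\<rbrakk>
    \<Longrightarrow> ltt L (LEnt \<Gamma> (IsFormula (Disj \<phi> \<psi>)))"
| l_impl: "\<lbrakk>ltt L (LEnt \<Gamma> (IsFormula \<phi>)); ltt L (LEnt \<Gamma> (IsFormula \<psi>))\<rbrakk>
    \<Longrightarrow> ltt L (LEnt \<Gamma> (IsFormula (Impl \<phi> \<psi>)))"
| l_forall: "ltt L (LEnt ((x, S) # \<Gamma>) (IsFormula \<phi>)) \<Longrightarrow> ltt L (LEnt \<Gamma> (IsFormula (Forall x S \<phi>)))"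
| l_exists: "ltt L (LEnt ((x, S) # \<Gamma>) (IsFormula \<phi>)) \<Longrightarrow> ltt L (LEnt \<Gamma> (IsFormula (Exists x S \<phi>)))"


section \<open>Homotopy type theory\<close>

text \<open>
  Raw types and terms, with de Bruijn indices.  Binding structure: the second argument of
  \<open>EPi\<close>, \<open>ELam\<close>, \<open>ESig\<close>, \<open>CPi\<close>, \<open>CSig\<close> binds one variable.  The first argument of each
  eliminator \<open>ESigInd\<close>, \<open>ESumInd\<close>, \<open>EOneInd\<close>, \<open>EZeroInd\<close>, \<open>EJ\<close> is the motive; it binds
  one variable (three, \<open>x y p\<close>, for \<open>EJ\<close>).  The second argument of \<open>ESigInd\<close> binds two
  variables, the branches of \<open>ESumInd\<close> and the second argument of \<open>EJ\<close> bind one.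
  \<open>CPi, ..., CTrunc\<close> are the codes in the universe \<open>EU\<close> with decoding \<open>EEl\<close>; \<open>EUa\<close> is the
  univalence axiom; \<open>ETrIn\<close>, \<open>ETrEq\<close>, \<open>ETrRec\<close> are point constructor, path constructor and
  recursor of the propositional truncation.
\<close>

datatype exp =
    EVar nat
  | EPi exp exp | ELam exp exp | EApp exp exp
  | ESig exp exp | EPair exp exp | ESigInd exp exp exp
  | ESum exp exp | EInl exp | EInr exp | ESumInd exp exp exp exp
  | EOne | EStar | EOneInd exp exp exp
  | EZero | EZeroInd exp exp
  | EId exp exp exp | ERefl exp | EJ exp exp exp exp exp
  | ETrunc exp | ETrIn exp | ETrEq exp exp | ETrRec exp exp exp exp
  | EU | EEl exp
  | CPi exp exp | CSig exp exp | CSum exp exp | COne | CZero | CId exp exp exp | CTrunc exp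
  | EUa

definition upr :: "(nat \<Rightarrow> nat) \<Rightarrow> nat \<Rightarrow> nat" where
  "upr \<rho> n = (case n of 0 \<Rightarrow> 0 | Suc m \<Rightarrow> Suc (\<rho> m))"

primrec ren :: "(nat \<Rightarrow> nat) \<Rightarrow> exp \<Rightarrow> exp" where
  "ren \<rho> (EVar n) = EVar (\<rho> n)"
| "ren \<rho> (EPi A B) = EPi (ren \<rho> A) (ren (upr \<rho>) B)"
| "ren \<rho> (ELam A b) = ELam (ren \<rho> A) (ren (upr \<rho>) b)"
| "ren \<rho> (EApp f a) = EApp (ren \<rho> f) (ren \<rho> a)"
| "ren \<rho> (ESig A B) = ESig (ren \<rho> A) (ren (upr \<rho>) B)"
| "ren \<rho> (EPair a b) = EPair (ren \<rho> a) (ren \<rho> b)"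
| "ren \<rho> (ESigInd C g p) = ESigInd (ren (upr \<rho>) C) (ren (upr (upr \<rho>)) g) (ren \<rho> p)"
| "ren \<rho> (ESum A B) = ESum (ren \<rho> A) (ren \<rho> B)"
| "ren \<rho> (EInl a) = EInl (ren \<rho> a)"
| "ren \<rho> (EInr b) = EInr (ren \<rho> b)"
| "ren \<rho> (ESumInd C c d p) = ESumInd (ren (upr \<rho>) C) (ren (upr \<rho>) c) (ren (upr \<rho>) d) (ren \<rho> p)"
| "ren \<rho> EOne = EOne"
| "ren \<rho> EStar = EStar"
| "ren \<rho> (EOneInd C c p) = EOneInd (ren (upr \<rho>) C) (ren \<rho> c) (ren \<rho> p)"
| "ren \<rho> EZero = EZero"
| "ren \<rho> (EZeroInd C p) = EZeroInd (ren (upr \<rho>) C) (ren \<rho> p)"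
| "ren \<rho> (EId A a b) = EId (ren \<rho> A) (ren \<rho> a) (ren \<rho> b)"
| "ren \<rho> (ERefl a) = ERefl (ren \<rho> a)"
| "ren \<rho> (EJ C c a b p) =
     EJ (ren (upr (upr (upr \<rho>))) C) (ren (upr \<rho>) c) (ren \<rho> a) (ren \<rho> b) (ren \<rho> p)"
| "ren \<rho> (ETrunc A) = ETrunc (ren \<rho> A)"
| "ren \<rho> (ETrIn a) = ETrIn (ren \<rho> a)"
| "ren \<rho> (ETrEq a b) = ETrEq (ren \<rho> a) (ren \<rho> b)"
| "ren \<rho> (ETrRec B q f t) = ETrRec (ren \<rho> B) (ren \<rho> q) (ren \<rho> f) (ren \<rho> t)"
| "ren \<rho> EU = EU"
| "ren \<rho> (EEl a) = EEl (ren \<rho> a)"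
| "ren \<rho> (CPi a b) = CPi (ren \<rho> a) (ren (upr \<rho>) b)"
| "ren \<rho> (CSig a b) = CSig (ren \<rho> a) (ren (upr \<rho>) b)"
| "ren \<rho> (CSum a b) = CSum (ren \<rho> a) (ren \<rho> b)"
| "ren \<rho> COne = COne"
| "ren \<rho> CZero = CZero"
| "ren \<rho> (CId a x y) = CId (ren \<rho> a) (ren \<rho> x) (ren \<rho> y)"
| "ren \<rho> (CTrunc a) = CTrunc (ren \<rho> a)"
| "ren \<rho> EUa = EUa"

abbreviation lift :: "exp \<Rightarrow> exp" where "lift \<equiv> ren Suc"

definition scons :: "exp \<Rightarrow> (nat \<Rightarrow> exp) \<Rightarrow> nat \<Rightarrow> exp" (infixr "\<bullet>" 65) where
  "(t \<bullet> \<sigma>) n = (case n of 0 \<Rightarrow> t | Suc m \<Rightarrow> \<sigma> m)"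

definition up :: "(nat \<Rightarrow> exp) \<Rightarrow> nat \<Rightarrow> exp" where
  "up \<sigma> = EVar 0 \<bullet> (\<lambda>n. lift (\<sigma> n))"

primrec sub :: "(nat \<Rightarrow> exp) \<Rightarrow> exp \<Rightarrow> exp" where
  "sub \<sigma> (EVar n) = \<sigma> n"
| "sub \<sigma> (EPi A B) = EPi (sub \<sigma> A) (sub (up \<sigma>) B)"
| "sub \<sigma> (ELam A b) = ELam (sub \<sigma> A) (sub (up \<sigma>) b)"
| "sub \<sigma> (EApp f a) = EApp (sub \<sigma> f) (sub \<sigma> a)"
| "sub \<sigma> (ESig A B) = ESig (sub \<sigma> A) (sub (up \<sigma>) B)"
| "sub \<sigma> (EPair a b) = EPair (sub \<sigma> a) (sub \<sigma> b)"
| "sub \<sigma> (ESigInd C g p) = ESigInd (sub (up \<sigma>) C) (sub (up (up \<sigma>)) g) (sub \<sigma> p)"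
| "sub \<sigma> (ESum A B) = ESum (sub \<sigma> A) (sub \<sigma> B)"
| "sub \<sigma> (EInl a) = EInl (sub \<sigma> a)"
| "sub \<sigma> (EInr b) = EInr (sub \<sigma> b)"
| "sub \<sigma> (ESumInd C c d p) = ESumInd (sub (up \<sigma>) C) (sub (up \<sigma>) c) (sub (up \<sigma>) d) (sub \<sigma> p)"
| "sub \<sigma> EOne = EOne"
| "sub \<sigma> EStar = EStar"
| "sub \<sigma> (EOneInd C c p) = EOneInd (sub (up \<sigma>) C) (sub \<sigma> c) (sub \<sigma> p)"
| "sub \<sigma> EZero = EZero"
| "sub \<sigma> (EZeroInd C p) = EZeroInd (sub (up \<sigma>) C) (sub \<sigma> p)"
| "sub \<sigma> (EId A a b) = EId (sub \<sigma> A) (sub \<sigma> a) (sub \<sigma> b)"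
| "sub \<sigma> (ERefl a) = ERefl (sub \<sigma> a)"
| "sub \<sigma> (EJ C c a b p) =
     EJ (sub (up (up (up \<sigma>))) C) (sub (up \<sigma>) c) (sub \<sigma> a) (sub \<sigma> b) (sub \<sigma> p)"
| "sub \<sigma> (ETrunc A) = ETrunc (sub \<sigma> A)"
| "sub \<sigma> (ETrIn a) = ETrIn (sub \<sigma> a)"
| "sub \<sigma> (ETrEq a b) = ETrEq (sub \<sigma> a) (sub \<sigma> b)"
| "sub \<sigma> (ETrRec B q f t) = ETrRec (sub \<sigma> B) (sub \<sigma> q) (sub \<sigma> f) (sub \<sigma> t)"
| "sub \<sigma> EU = EU"
| "sub \<sigma> (EEl a) = EEl (sub \<sigma> a)"
| "sub \<sigma> (CPi a b) = CPi (sub \<sigma> a) (sub (up \<sigma>) b)"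
| "sub \<sigma> (CSig a b) = CSig (sub \<sigma> a) (sub (up \<sigma>) b)"
| "sub \<sigma> (CSum a b) = CSum (sub \<sigma> a) (sub \<sigma> b)"
| "sub \<sigma> COne = COne"
| "sub \<sigma> CZero = CZero"
| "sub \<sigma> (CId a x y) = CId (sub \<sigma> a) (sub \<sigma> x) (sub \<sigma> y)"
| "sub \<sigma> (CTrunc a) = CTrunc (sub \<sigma> a)"
| "sub \<sigma> EUa = EUa"

text \<open>
  \<open>inst B a\<close> is \<open>B[a]\<close>; \<open>reinst k u C\<close> lives in a context extended by \<open>k\<close> variables and
  replaces the variable bound in \<open>C\<close> by the term \<open>u\<close> of the extended context.
\<close>

definition inst :: "exp \<Rightarrow> exp \<Rightarrow> exp" where
  "inst B a = sub (a \<bullet> EVar) B"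

definition reinst :: "nat \<Rightarrow> exp \<Rightarrow> exp \<Rightarrow> exp" where
  "reinst k u C = sub (u \<bullet> (\<lambda>n. EVar (n + k))) C"

definition EArr :: "exp \<Rightarrow> exp \<Rightarrow> exp" where
  "EArr A B = EPi A (lift B)"

definition ETimes :: "exp \<Rightarrow> exp \<Rightarrow> exp" where
  "ETimes A B = ESig A (lift B)"

definition is_prop :: "exp \<Rightarrow> exp" where
  "is_prop A = EPi A (EPi (lift A) (EId (lift (lift A)) (EVar 1) (EVar 0)))"

definition is_contr :: "exp \<Rightarrow> exp" where
  "is_contr A = ESig A (EPi (lift A) (EId (lift (lift A)) (EVar 1) (EVar 0)))"

primrec is_hlevel :: "nat \<Rightarrow> exp \<Rightarrow> exp" where
  "is_hlevel 0 A = is_contr A"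
| "is_hlevel (Suc n) A =
     EPi A (EPi (lift A) (is_hlevel n (EId (lift (lift A)) (EVar 1) (EVar 0))))"

text \<open>Equivalences are maps with a right inverse and a left inverse.\<close>

definition is_equiv :: "exp \<Rightarrow> exp \<Rightarrow> exp \<Rightarrow> exp" where
  "is_equiv A B f = ETimes
     (ESig (EArr B A) (EPi (lift B)
        (EId (lift (lift B)) (EApp (lift (lift f)) (EApp (EVar 1) (EVar 0))) (EVar 0))))
     (ESig (EArr B A) (EPi (lift A)
        (EId (lift (lift A)) (EApp (EVar 1) (EApp (lift (lift f)) (EVar 0))) (EVar 0))))"

definition equiv_type :: "exp \<Rightarrow> exp \<Rightarrow> exp" where
  "equiv_type A B = ESig (EArr A B) (is_equiv (lift A) (lift B) (EVar 0))"

definition id_equiv :: "exp \<Rightarrow> exp" where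
  "id_equiv A = (let i = ELam A (EVar 0); h = ELam A (ERefl (EVar 0)) in
     EPair i (EPair (EPair i h) (EPair i h)))"

definition id_to_equiv :: "exp \<Rightarrow> exp \<Rightarrow> exp" where
  "id_to_equiv a b = ELam (EId EU a b)
     (EJ (equiv_type (EEl (EVar 2)) (EEl (EVar 1))) (id_equiv (EEl (EVar 0)))
         (lift a) (lift b) (EVar 0))"

definition univalence_type :: exp where
  "univalence_type = EPi EU (EPi EU
     (is_equiv (EId EU (EVar 1) (EVar 0))
               (equiv_type (EEl (EVar 1)) (EEl (EVar 0)))
               (id_to_equiv (EVar 1) (EVar 0))))"

type_synonym hctx = "exp list"

datatype hbody = IsType exp | TypeEq exp exp | HasType exp exp | TermEq exp exp exp

datatype hjudgement = HCtx hctx | HEnt hctx hbody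

primrec bsub :: "(nat \<Rightarrow> exp) \<Rightarrow> hbody \<Rightarrow> hbody" where
  "bsub \<sigma> (IsType A) = IsType (sub \<sigma> A)"
| "bsub \<sigma> (TypeEq A B) = TypeEq (sub \<sigma> A) (sub \<sigma> B)"
| "bsub \<sigma> (HasType a A) = HasType (sub \<sigma> a) (sub \<sigma> A)"
| "bsub \<sigma> (TermEq a b A) = TermEq (sub \<sigma> a) (sub \<sigma> b) (sub \<sigma> A)"

text \<open>Substitution in a context extension \<open>\<Delta>\<close>, entry by entry.\<close>

primrec tsub :: "(nat \<Rightarrow> exp) \<Rightarrow> hctx \<Rightarrow> hctx" where
  "tsub \<sigma> [] = []"
| "tsub \<sigma> (A # \<Delta>) = sub ((up ^^ length \<Delta>) \<sigma>) A # tsub \<sigma> \<Delta>"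

text \<open>
  Besides weakening and substitution, substitution of judgementally equal terms is taken as
  a structural rule; these rules are admissible from the remaining ones.
\<close>

inductive hott :: "hjudgement \<Rightarrow> bool" where
  ctx_empty: "hott (HCtx [])"
| ctx_extend: "hott (HEnt \<Gamma> (IsType A)) \<Longrightarrow> hott (HCtx (A # \<Gamma>))"
| var: "\<lbrakk>hott (HCtx \<Gamma>); i < length \<Gamma>\<rbrakk>
    \<Longrightarrow> hott (HEnt \<Gamma> (HasType (EVar i) (ren (\<lambda>n. n + Suc i) (\<Gamma> ! i))))"
| weaken: "\<lbrakk>hott (HEnt \<Gamma> (IsType A)); hott (HEnt (\<Delta> @ \<Gamma>) J)\<rbrakk>
    \<Longrightarrow> hott (HEnt (tsub (\<lambda>n. EVar (Suc n)) \<Delta> @ A # \<Gamma>)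
               (bsub ((up ^^ length \<Delta>) (\<lambda>n. EVar (Suc n))) J))"
| subst: "\<lbrakk>hott (HEnt \<Gamma> (HasType a A)); hott (HEnt (\<Delta> @ A # \<Gamma>) J)\<rbrakk>
    \<Longrightarrow> hott (HEnt (tsub (a \<bullet> EVar) \<Delta> @ \<Gamma>) (bsub ((up ^^ length \<Delta>) (a \<bullet> EVar)) J))"
| subst_type_eq: "\<lbrakk>hott (HEnt \<Gamma> (TermEq a a' A)); hott (HEnt (A # \<Gamma>) (IsType B))\<rbrakk>
    \<Longrightarrow> hott (HEnt \<Gamma> (TypeEq (inst B a) (inst B a')))"
| subst_term_eq: "\<lbrakk>hott (HEnt \<Gamma> (TermEq a a' A)); hott (HEnt (A # \<Gamma>) (HasType b B))\<rbrakk>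
    \<Longrightarrow> hott (HEnt \<Gamma> (TermEq (inst b a) (inst b a') (inst B a)))"

| type_refl: "hott (HEnt \<Gamma> (IsType A)) \<Longrightarrow> hott (HEnt \<Gamma> (TypeEq A A))"
| type_sym: "hott (HEnt \<Gamma> (TypeEq A B)) \<Longrightarrow> hott (HEnt \<Gamma> (TypeEq B A))"
| type_trans: "\<lbrakk>hott (HEnt \<Gamma> (TypeEq A B)); hott (HEnt \<Gamma> (TypeEq B C))\<rbrakk>
    \<Longrightarrow> hott (HEnt \<Gamma> (TypeEq A C))"
| term_refl: "hott (HEnt \<Gamma> (HasType a A)) \<Longrightarrow> hott (HEnt \<Gamma> (TermEq a a A))"
| term_sym: "hott (HEnt \<Gamma> (TermEq a b A)) \<Longrightarrow> hott (HEnt \<Gamma> (TermEq b a A))"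
| term_trans: "\<lbrakk>hott (HEnt \<Gamma> (TermEq a b A)); hott (HEnt \<Gamma> (TermEq b c A))\<rbrakk>
    \<Longrightarrow> hott (HEnt \<Gamma> (TermEq a c A))"
| conv: "\<lbrakk>hott (HEnt \<Gamma> (HasType a A)); hott (HEnt \<Gamma> (TypeEq A B))\<rbrakk>
    \<Longrightarrow> hott (HEnt \<Gamma> (HasType a B))"
| conv_eq: "\<lbrakk>hott (HEnt \<Gamma> (TermEq a b A)); hott (HEnt \<Gamma> (TypeEq A B))\<rbrakk>
    \<Longrightarrow> hott (HEnt \<Gamma> (TermEq a b B))"

| pi_form: "\<lbrakk>hott (HEnt \<Gamma> (IsType A)); hott (HEnt (A # \<Gamma>) (IsType B))\<rbrakk>
    \<Longrightarrow> hott (HEnt \<Gamma> (IsType (EPi A B)))"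
| pi_cong: "\<lbrakk>hott (HEnt \<Gamma> (TypeEq A A')); hott (HEnt (A # \<Gamma>) (TypeEq B B'))\<rbrakk>
    \<Longrightarrow> hott (HEnt \<Gamma> (TypeEq (EPi A B) (EPi A' B')))"
| lam: "\<lbrakk>hott (HEnt \<Gamma> (IsType A)); hott (HEnt (A # \<Gamma>) (HasType b B))\<rbrakk>
    \<Longrightarrow> hott (HEnt \<Gamma> (HasType (ELam A b) (EPi A B)))"
| lam_cong: "\<lbrakk>hott (HEnt \<Gamma> (TypeEq A A')); hott (HEnt (A # \<Gamma>) (TermEq b b' B))\<rbrakk>
    \<Longrightarrow> hott (HEnt \<Gamma> (TermEq (ELam A b) (ELam A' b') (EPi A B)))"
| app: "\<lbrakk>hott (HEnt \<Gamma> (HasType f (EPi A B))); hott (HEnt \<Gamma> (HasType a A))\<rbrakk>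
    \<Longrightarrow> hott (HEnt \<Gamma> (HasType (EApp f a) (inst B a)))"
| app_cong: "\<lbrakk>hott (HEnt \<Gamma> (TermEq f f' (EPi A B))); hott (HEnt \<Gamma> (TermEq a a' A))\<rbrakk>
    \<Longrightarrow> hott (HEnt \<Gamma> (TermEq (EApp f a) (EApp f' a') (inst B a)))"
| pi_beta: "\<lbrakk>hott (HEnt (A # \<Gamma>) (HasType b B)); hott (HEnt \<Gamma> (HasType a A))\<rbrakk>
    \<Longrightarrow> hott (HEnt \<Gamma> (TermEq (EApp (ELam A b) a) (inst b a) (inst B a)))"
| pi_eta: "hott (HEnt \<Gamma> (HasType f (EPi A B)))
    \<Longrightarrow> hott (HEnt \<Gamma> (TermEq f (ELam A (EApp (lift f) (EVar 0))) (EPi A B)))"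

| sig_form: "\<lbrakk>hott (HEnt \<Gamma> (IsType A)); hott (HEnt (A # \<Gamma>) (IsType B))\<rbrakk>
    \<Longrightarrow> hott (HEnt \<Gamma> (IsType (ESig A B)))"
| sig_cong: "\<lbrakk>hott (HEnt \<Gamma> (TypeEq A A')); hott (HEnt (A # \<Gamma>) (TypeEq B B'))\<rbrakk>
    \<Longrightarrow> hott (HEnt \<Gamma> (TypeEq (ESig A B) (ESig A' B')))"
| pair: "\<lbrakk>hott (HEnt (A # \<Gamma>) (IsType B)); hott (HEnt \<Gamma> (HasType a A));
     hott (HEnt \<Gamma> (HasType b (inst B a)))\<rbrakk>
    \<Longrightarrow> hott (HEnt \<Gamma> (HasType (EPair a b) (ESig A B)))"
| pair_cong: "\<lbrakk>hott (HEnt (A # \<Gamma>) (IsType B)); hott (HEnt \<Gamma> (TermEq a a' A));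
     hott (HEnt \<Gamma> (TermEq b b' (inst B a)))\<rbrakk>
    \<Longrightarrow> hott (HEnt \<Gamma> (TermEq (EPair a b) (EPair a' b') (ESig A B)))"
| sig_ind: "\<lbrakk>hott (HEnt (ESig A B # \<Gamma>) (IsType C));
     hott (HEnt (B # A # \<Gamma>) (HasType g (reinst 2 (EPair (EVar 1) (EVar 0)) C)));
     hott (HEnt \<Gamma> (HasType p (ESig A B)))\<rbrakk>
    \<Longrightarrow> hott (HEnt \<Gamma> (HasType (ESigInd C g p) (inst C p)))"
| sig_ind_cong: "\<lbrakk>hott (HEnt (ESig A B # \<Gamma>) (TypeEq C C'));
     hott (HEnt (B # A # \<Gamma>) (TermEq g g' (reinst 2 (EPair (EVar 1) (EVar 0)) C)));
     hott (HEnt \<Gamma> (TermEq p p' (ESig A B)))\<rbrakk>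
    \<Longrightarrow> hott (HEnt \<Gamma> (TermEq (ESigInd C g p) (ESigInd C' g' p') (inst C p)))"
| sig_beta: "\<lbrakk>hott (HEnt (ESig A B # \<Gamma>) (IsType C));
     hott (HEnt (B # A # \<Gamma>) (HasType g (reinst 2 (EPair (EVar 1) (EVar 0)) C)));
     hott (HEnt \<Gamma> (HasType a A)); hott (HEnt \<Gamma> (HasType b (inst B a)))\<rbrakk>
    \<Longrightarrow> hott (HEnt \<Gamma> (TermEq (ESigInd C g (EPair a b)) (sub (b \<bullet> a \<bullet> EVar) g)
               (inst C (EPair a b))))"

| sum_form: "\<lbrakk>hott (HEnt \<Gamma> (IsType A)); hott (HEnt \<Gamma> (IsType B))\<rbrakk>
    \<Longrightarrow> hott (HEnt \<Gamma> (IsType (ESum A B)))"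
| sum_cong: "\<lbrakk>hott (HEnt \<Gamma> (TypeEq A A')); hott (HEnt \<Gamma> (TypeEq B B'))\<rbrakk>
    \<Longrightarrow> hott (HEnt \<Gamma> (TypeEq (ESum A B) (ESum A' B')))"
| inl: "\<lbrakk>hott (HEnt \<Gamma> (IsType B)); hott (HEnt \<Gamma> (HasType a A))\<rbrakk>
    \<Longrightarrow> hott (HEnt \<Gamma> (HasType (EInl a) (ESum A B)))"
| inl_cong: "\<lbrakk>hott (HEnt \<Gamma> (IsType B)); hott (HEnt \<Gamma> (TermEq a a' A))\<rbrakk>
    \<Longrightarrow> hott (HEnt \<Gamma> (TermEq (EInl a) (EInl a') (ESum A B)))"
| inr: "\<lbrakk>hott (HEnt \<Gamma> (IsType A)); hott (HEnt \<Gamma> (HasType b B))\<rbrakk>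
    \<Longrightarrow> hott (HEnt \<Gamma> (HasType (EInr b) (ESum A B)))"
| inr_cong: "\<lbrakk>hott (HEnt \<Gamma> (IsType A)); hott (HEnt \<Gamma> (TermEq b b' B))\<rbrakk>
    \<Longrightarrow> hott (HEnt \<Gamma> (TermEq (EInr b) (EInr b') (ESum A B)))"
| sum_ind: "\<lbrakk>hott (HEnt (ESum A B # \<Gamma>) (IsType C));
     hott (HEnt (A # \<Gamma>) (HasType c (reinst 1 (EInl (EVar 0)) C)));
     hott (HEnt (B # \<Gamma>) (HasType d (reinst 1 (EInr (EVar 0)) C)));
     hott (HEnt \<Gamma> (HasType p (ESum A B)))\<rbrakk>
    \<Longrightarrow> hott (HEnt \<Gamma> (HasType (ESumInd C c d p) (inst C p)))"
| sum_ind_cong: "\<lbrakk>hott (HEnt (ESum A B # \<Gamma>) (TypeEq C C'));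
     hott (HEnt (A # \<Gamma>) (TermEq c c' (reinst 1 (EInl (EVar 0)) C)));
     hott (HEnt (B # \<Gamma>) (TermEq d d' (reinst 1 (EInr (EVar 0)) C)));
     hott (HEnt \<Gamma> (TermEq p p' (ESum A B)))\<rbrakk>
    \<Longrightarrow> hott (HEnt \<Gamma> (TermEq (ESumInd C c d p) (ESumInd C' c' d' p') (inst C p)))"
| sum_beta_inl: "\<lbrakk>hott (HEnt (ESum A B # \<Gamma>) (IsType C));
     hott (HEnt (A # \<Gamma>) (HasType c (reinst 1 (EInl (EVar 0)) C)));
     hott (HEnt (B # \<Gamma>) (HasType d (reinst 1 (EInr (EVar 0)) C)));
     hott (HEnt \<Gamma> (HasType a A))\<rbrakk>
    \<Longrightarrow> hott (HEnt \<Gamma> (TermEq (ESumInd C c d (EInl a)) (inst c a) (inst C (EInl a))))"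
| sum_beta_inr: "\<lbrakk>hott (HEnt (ESum A B # \<Gamma>) (IsType C));
     hott (HEnt (A # \<Gamma>) (HasType c (reinst 1 (EInl (EVar 0)) C)));
     hott (HEnt (B # \<Gamma>) (HasType d (reinst 1 (EInr (EVar 0)) C)));
     hott (HEnt \<Gamma> (HasType b B))\<rbrakk>
    \<Longrightarrow> hott (HEnt \<Gamma> (TermEq (ESumInd C c d (EInr b)) (inst d b) (inst C (EInr b))))"

| one_form: "hott (HCtx \<Gamma>) \<Longrightarrow> hott (HEnt \<Gamma> (IsType EOne))"
| star: "hott (HCtx \<Gamma>) \<Longrightarrow> hott (HEnt \<Gamma> (HasType EStar EOne))"
| one_ind: "\<lbrakk>hott (HEnt (EOne # \<Gamma>) (IsType C)); hott (HEnt \<Gamma> (HasType c (inst C EStar)));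
     hott (HEnt \<Gamma> (HasType p EOne))\<rbrakk>
    \<Longrightarrow> hott (HEnt \<Gamma> (HasType (EOneInd C c p) (inst C p)))"
| one_ind_cong: "\<lbrakk>hott (HEnt (EOne # \<Gamma>) (TypeEq C C'));
     hott (HEnt \<Gamma> (TermEq c c' (inst C EStar))); hott (HEnt \<Gamma> (TermEq p p' EOne))\<rbrakk>
    \<Longrightarrow> hott (HEnt \<Gamma> (TermEq (EOneInd C c p) (EOneInd C' c' p') (inst C p)))"
| one_beta: "\<lbrakk>hott (HEnt (EOne # \<Gamma>) (IsType C)); hott (HEnt \<Gamma> (HasType c (inst C EStar)))\<rbrakk>
    \<Longrightarrow> hott (HEnt \<Gamma> (TermEq (EOneInd C c EStar) c (inst C EStar)))"

| zero_form: "hott (HCtx \<Gamma>) \<Longrightarrow> hott (HEnt \<Gamma> (IsType EZero))"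
| zero_ind: "\<lbrakk>hott (HEnt (EZero # \<Gamma>) (IsType C)); hott (HEnt \<Gamma> (HasType p EZero))\<rbrakk>
    \<Longrightarrow> hott (HEnt \<Gamma> (HasType (EZeroInd C p) (inst C p)))"
| zero_ind_cong: "\<lbrakk>hott (HEnt (EZero # \<Gamma>) (TypeEq C C')); hott (HEnt \<Gamma> (TermEq p p' EZero))\<rbrakk>
    \<Longrightarrow> hott (HEnt \<Gamma> (TermEq (EZeroInd C p) (EZeroInd C' p') (inst C p)))"

| id_form: "\<lbrakk>hott (HEnt \<Gamma> (IsType A)); hott (HEnt \<Gamma> (HasType a A)); hott (HEnt \<Gamma> (HasType b A))\<rbrakk>
    \<Longrightarrow> hott (HEnt \<Gamma> (IsType (EId A a b)))"
| id_cong: "\<lbrakk>hott (HEnt \<Gamma> (TypeEq A A')); hott (HEnt \<Gamma> (TermEq a a' A)); hott (HEnt \<Gamma> (TermEq b b' A))\<rbrakk>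
    \<Longrightarrow> hott (HEnt \<Gamma> (TypeEq (EId A a b) (EId A' a' b')))"
| refl: "hott (HEnt \<Gamma> (HasType a A)) \<Longrightarrow> hott (HEnt \<Gamma> (HasType (ERefl a) (EId A a a)))"
| refl_cong: "hott (HEnt \<Gamma> (TermEq a a' A))
    \<Longrightarrow> hott (HEnt \<Gamma> (TermEq (ERefl a) (ERefl a') (EId A a a)))"
| id_ind: "\<lbrakk>hott (HEnt (EId (lift (lift A)) (EVar 1) (EVar 0) # lift A # A # \<Gamma>) (IsType C));
     hott (HEnt (A # \<Gamma>)
       (HasType c (sub (ERefl (EVar 0) \<bullet> EVar 0 \<bullet> EVar 0 \<bullet> (\<lambda>n. EVar (Suc n))) C)));
     hott (HEnt \<Gamma> (HasType a A)); hott (HEnt \<Gamma> (HasType b A));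
     hott (HEnt \<Gamma> (HasType p (EId A a b)))\<rbrakk>
    \<Longrightarrow> hott (HEnt \<Gamma> (HasType (EJ C c a b p) (sub (p \<bullet> b \<bullet> a \<bullet> EVar) C)))"
| id_ind_cong: "\<lbrakk>hott (HEnt (EId (lift (lift A)) (EVar 1) (EVar 0) # lift A # A # \<Gamma>) (TypeEq C C'));
     hott (HEnt (A # \<Gamma>)
       (TermEq c c' (sub (ERefl (EVar 0) \<bullet> EVar 0 \<bullet> EVar 0 \<bullet> (\<lambda>n. EVar (Suc n))) C)));
     hott (HEnt \<Gamma> (TermEq a a' A)); hott (HEnt \<Gamma> (TermEq b b' A));
     hott (HEnt \<Gamma> (TermEq p p' (EId A a b)))\<rbrakk>
    \<Longrightarrow> hott (HEnt \<Gamma> (TermEq (EJ C c a b p) (EJ C' c' a' b' p') (sub (p \<bullet> b \<bullet> a \<bullet> EVar) C)))"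
| id_beta: "\<lbrakk>hott (HEnt (EId (lift (lift A)) (EVar 1) (EVar 0) # lift A # A # \<Gamma>) (IsType C));
     hott (HEnt (A # \<Gamma>)
       (HasType c (sub (ERefl (EVar 0) \<bullet> EVar 0 \<bullet> EVar 0 \<bullet> (\<lambda>n. EVar (Suc n))) C)));
     hott (HEnt \<Gamma> (HasType a A))\<rbrakk>
    \<Longrightarrow> hott (HEnt \<Gamma> (TermEq (EJ C c a a (ERefl a)) (inst c a) (sub (ERefl a \<bullet> a \<bullet> a \<bullet> EVar) C)))"

| trunc_form: "hott (HEnt \<Gamma> (IsType A)) \<Longrightarrow> hott (HEnt \<Gamma> (IsType (ETrunc A)))"
| trunc_cong: "hott (HEnt \<Gamma> (TypeEq A A')) \<Longrightarrow> hott (HEnt \<Gamma> (TypeEq (ETrunc A) (ETrunc A')))"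
| trunc_in: "hott (HEnt \<Gamma> (HasType a A)) \<Longrightarrow> hott (HEnt \<Gamma> (HasType (ETrIn a) (ETrunc A)))"
| trunc_in_cong: "hott (HEnt \<Gamma> (TermEq a a' A))
    \<Longrightarrow> hott (HEnt \<Gamma> (TermEq (ETrIn a) (ETrIn a') (ETrunc A)))"
| trunc_eq: "\<lbrakk>hott (HEnt \<Gamma> (HasType x (ETrunc A))); hott (HEnt \<Gamma> (HasType y (ETrunc A)))\<rbrakk>
    \<Longrightarrow> hott (HEnt \<Gamma> (HasType (ETrEq x y) (EId (ETrunc A) x y)))"
| trunc_eq_cong: "\<lbrakk>hott (HEnt \<Gamma> (TermEq x x' (ETrunc A))); hott (HEnt \<Gamma> (TermEq y y' (ETrunc A)))\<rbrakk>
    \<Longrightarrow> hott (HEnt \<Gamma> (TermEq (ETrEq x y) (ETrEq x' y') (EId (ETrunc A) x y)))"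
| trunc_rec: "\<lbrakk>hott (HEnt \<Gamma> (IsType B)); hott (HEnt \<Gamma> (HasType q (is_prop B)));
     hott (HEnt \<Gamma> (HasType f (EArr A B))); hott (HEnt \<Gamma> (HasType t (ETrunc A)))\<rbrakk>
    \<Longrightarrow> hott (HEnt \<Gamma> (HasType (ETrRec B q f t) B))"
| trunc_rec_cong: "\<lbrakk>hott (HEnt \<Gamma> (TypeEq B B')); hott (HEnt \<Gamma> (TermEq q q' (is_prop B)));
     hott (HEnt \<Gamma> (TermEq f f' (EArr A B))); hott (HEnt \<Gamma> (TermEq t t' (ETrunc A)))\<rbrakk>
    \<Longrightarrow> hott (HEnt \<Gamma> (TermEq (ETrRec B q f t) (ETrRec B' q' f' t') B))"
| trunc_beta: "\<lbrakk>hott (HEnt \<Gamma> (IsType B)); hott (HEnt \<Gamma> (HasType q (is_prop B)));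
     hott (HEnt \<Gamma> (HasType f (EArr A B))); hott (HEnt \<Gamma> (HasType a A))\<rbrakk>
    \<Longrightarrow> hott (HEnt \<Gamma> (TermEq (ETrRec B q f (ETrIn a)) (EApp f a) B))"

| univ_form: "hott (HCtx \<Gamma>) \<Longrightarrow> hott (HEnt \<Gamma> (IsType EU))"
| el_form: "hott (HEnt \<Gamma> (HasType a EU)) \<Longrightarrow> hott (HEnt \<Gamma> (IsType (EEl a)))"
| el_cong: "hott (HEnt \<Gamma> (TermEq a a' EU)) \<Longrightarrow> hott (HEnt \<Gamma> (TypeEq (EEl a) (EEl a')))"
| code_pi: "\<lbrakk>hott (HEnt \<Gamma> (HasType a EU)); hott (HEnt (EEl a # \<Gamma>) (HasType b EU))\<rbrakk>
    \<Longrightarrow> hott (HEnt \<Gamma> (HasType (CPi a b) EU))"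
| code_pi_cong: "\<lbrakk>hott (HEnt \<Gamma> (TermEq a a' EU)); hott (HEnt (EEl a # \<Gamma>) (TermEq b b' EU))\<rbrakk>
    \<Longrightarrow> hott (HEnt \<Gamma> (TermEq (CPi a b) (CPi a' b') EU))"
| el_pi: "\<lbrakk>hott (HEnt \<Gamma> (HasType a EU)); hott (HEnt (EEl a # \<Gamma>) (HasType b EU))\<rbrakk>
    \<Longrightarrow> hott (HEnt \<Gamma> (TypeEq (EEl (CPi a b)) (EPi (EEl a) (EEl b))))"
| code_sig: "\<lbrakk>hott (HEnt \<Gamma> (HasType a EU)); hott (HEnt (EEl a # \<Gamma>) (HasType b EU))\<rbrakk>
    \<Longrightarrow> hott (HEnt \<Gamma> (HasType (CSig a b) EU))"
| code_sig_cong: "\<lbrakk>hott (HEnt \<Gamma> (TermEq a a' EU)); hott (HEnt (EEl a # \<Gamma>) (TermEq b b' EU))\<rbrakk>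
    \<Longrightarrow> hott (HEnt \<Gamma> (TermEq (CSig a b) (CSig a' b') EU))"
| el_sig: "\<lbrakk>hott (HEnt \<Gamma> (HasType a EU)); hott (HEnt (EEl a # \<Gamma>) (HasType b EU))\<rbrakk>
    \<Longrightarrow> hott (HEnt \<Gamma> (TypeEq (EEl (CSig a b)) (ESig (EEl a) (EEl b))))"
| code_sum: "\<lbrakk>hott (HEnt \<Gamma> (HasType a EU)); hott (HEnt \<Gamma> (HasType b EU))\<rbrakk>
    \<Longrightarrow> hott (HEnt \<Gamma> (HasType (CSum a b) EU))"
| code_sum_cong: "\<lbrakk>hott (HEnt \<Gamma> (TermEq a a' EU)); hott (HEnt \<Gamma> (TermEq b b' EU))\<rbrakk>
    \<Longrightarrow> hott (HEnt \<Gamma> (TermEq (CSum a b) (CSum a' b') EU))"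
| el_sum: "\<lbrakk>hott (HEnt \<Gamma> (HasType a EU)); hott (HEnt \<Gamma> (HasType b EU))\<rbrakk>
    \<Longrightarrow> hott (HEnt \<Gamma> (TypeEq (EEl (CSum a b)) (ESum (EEl a) (EEl b))))"
| code_one: "hott (HCtx \<Gamma>) \<Longrightarrow> hott (HEnt \<Gamma> (HasType COne EU))"
| el_one: "hott (HCtx \<Gamma>) \<Longrightarrow> hott (HEnt \<Gamma> (TypeEq (EEl COne) EOne))"
| code_zero: "hott (HCtx \<Gamma>) \<Longrightarrow> hott (HEnt \<Gamma> (HasType CZero EU))"
| el_zero: "hott (HCtx \<Gamma>) \<Longrightarrow> hott (HEnt \<Gamma> (TypeEq (EEl CZero) EZero))"
| code_id: "\<lbrakk>hott (HEnt \<Gamma> (HasType a EU)); hott (HEnt \<Gamma> (HasType x (EEl a)));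
     hott (HEnt \<Gamma> (HasType y (EEl a)))\<rbrakk>
    \<Longrightarrow> hott (HEnt \<Gamma> (HasType (CId a x y) EU))"
| code_id_cong: "\<lbrakk>hott (HEnt \<Gamma> (TermEq a a' EU)); hott (HEnt \<Gamma> (TermEq x x' (EEl a)));
     hott (HEnt \<Gamma> (TermEq y y' (EEl a)))\<rbrakk>
    \<Longrightarrow> hott (HEnt \<Gamma> (TermEq (CId a x y) (CId a' x' y') EU))"
| el_id: "\<lbrakk>hott (HEnt \<Gamma> (HasType a EU)); hott (HEnt \<Gamma> (HasType x (EEl a)));
     hott (HEnt \<Gamma> (HasType y (EEl a)))\<rbrakk>
    \<Longrightarrow> hott (HEnt \<Gamma> (TypeEq (EEl (CId a x y)) (EId (EEl a) x y)))"
| code_trunc: "hott (HEnt \<Gamma> (HasType a EU)) \<Longrightarrow> hott (HEnt \<Gamma> (HasType (CTrunc a) EU))"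
| code_trunc_cong: "hott (HEnt \<Gamma> (TermEq a a' EU))
    \<Longrightarrow> hott (HEnt \<Gamma> (TermEq (CTrunc a) (CTrunc a') EU))"
| el_trunc: "hott (HEnt \<Gamma> (HasType a EU))
    \<Longrightarrow> hott (HEnt \<Gamma> (TypeEq (EEl (CTrunc a)) (ETrunc (EEl a))))"
| univalence: "hott (HCtx \<Gamma>) \<Longrightarrow> hott (HEnt \<Gamma> (HasType EUa univalence_type))"


section \<open>The type of structures and the interpretation\<close>

text \<open>Projections from \<open>ESig A B\<close>.\<close>

definition proj1 :: "exp \<Rightarrow> exp \<Rightarrow> exp" where
  "proj1 A p = ESigInd (lift A) (EVar 1) p"

definition proj2 :: "exp \<Rightarrow> exp \<Rightarrow> exp \<Rightarrow> exp" where
  "proj2 A B p = ESigInd (reinst 1 (proj1 (lift A) (EVar 0)) B) (EVar 0) p"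

text \<open>
  \<open>transport A C a b p u\<close> transports \<open>u : C[a]\<close> along \<open>p : Id A a b\<close> in the family \<open>C\<close>, which binds
  one variable; the motive is \<open>C[x] \<rightarrow> C[y]\<close>.  (The type \<open>A\<close> does not occur in the term.)
\<close>

definition transport :: "exp \<Rightarrow> exp \<Rightarrow> exp \<Rightarrow> exp \<Rightarrow> exp \<Rightarrow> exp" where
  "transport C a b p u =
     EApp (EJ (EArr (reinst 3 (EVar 2) C) (reinst 3 (EVar 1) C)) (ELam C (EVar 0)) a b p) u"

text \<open>\<open>U_h m\<close> is the type of types of h-level \<open>m\<close>, and \<open>El_h m\<close> is its decoding.\<close>

definition U_h :: "enat \<Rightarrow> exp" where
  "U_h m = (case m of enat n \<Rightarrow> ESig EU (is_hlevel n (EEl (EVar 0))) | \<infinity> \<Rightarrow> EU)"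

definition El_h :: "enat \<Rightarrow> exp \<Rightarrow> exp" where
  "El_h m t = (case m of enat n \<Rightarrow> EEl (proj1 EU t) | \<infinity> \<Rightarrow> EEl t)"

definition sorts_below :: "('o, 'a) signature \<Rightarrow> 'o \<Rightarrow> 'o set" where
  "sorts_below L K = Cod L ` out L K"

lemma sorts_below_less:
  assumes L: "h_signature L" and K: "K \<in> Ob L" and f: "f \<in> out L K"
  shows "card (sorts_below L (Cod L f)) < card (sorts_below L K)"
proof (rule psubset_card_mono)
  have inv: "inverse_category L" and po: "proper_order L"
    using L by (auto simp: h_signature_def FOLDS_signature_def)
  then have cat: "category L" by (simp add: inverse_category_def)
  have "finite {f \<in> Arr L. Dom L f = K}" using inv K by (simp add: inverse_category_def)
  then have "finite (out L K)" by (rule rev_finite_subset) (auto simp: out_def)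
  then show "finite (sorts_below L K)" by (simp add: sorts_below_def)
  have fA: "f \<in> Arr L" "Dom L f = K" using f by (auto simp: out_def)
  then have CO: "Cod L f \<in> Ob L" using cat by (simp add: category_def)
  have irr: "\<not> oless L X X" if "X \<in> Ob L" for X
    using po that by (simp add: proper_order_def strict_linear_on_def)
  have dec: "oless L (Cod L g) X" if "X \<in> Ob L" "g \<in> out L X" for g X
    using po that by (auto simp: proper_order_def)
  have tr: "oless L X Z" if "oless L X Y" "oless L Y Z" "X \<in> Ob L" "Y \<in> Ob L" "Z \<in> Ob L" for X Y Z
    using po that unfolding proper_order_def strict_linear_on_def by blast
  show "sorts_below L (Cod L f) \<subset> sorts_below L K"
  proof
    show "sorts_below L (Cod L f) \<subseteq> sorts_below L K"
    proof
      fix X assume "X \<in> sorts_below L (Cod L f)"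
      then obtain g where g: "g \<in> out L (Cod L f)" and X: "X = Cod L g"
        by (auto simp: sorts_below_def)
      have gA: "g \<in> Arr L" "Dom L g = Cod L f" using g by (auto simp: out_def)
      then have gf: "is_arrow L (Cmp L g f) K X"
        using cat fA X unfolding category_def by blast
      have XO: "X \<in> Ob L" using cat gA X by (simp add: category_def)
      have "oless L X K" using dec[OF CO g] dec[OF K f] X tr XO CO K by blast
      then have "Cmp L g f \<noteq> Idn L K"
        using gf irr K cat by (auto simp: is_arrow_def category_def)
      then show "X \<in> sorts_below L K" using gf
        by (auto simp: sorts_below_def out_def is_arrow_def)
    qed
    have "Cod L f \<notin> sorts_below L (Cod L f)"
      using dec[OF CO] irr[OF CO] by (force simp: sorts_below_def)
    moreover have "Cod L f \<in> sorts_below L K" using f by (simp add: sorts_below_def)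
    ultimately show "sorts_below L (Cod L f) \<noteq> sorts_below L K" by blast
  qed
qed

lemma top_arrow_out: "f \<in> top_arrows L X \<Longrightarrow> f \<in> out L X"
  by (auto simp: top_arrows_def top_level_def nonid_def out_def)

lemma iso_less:
  assumes "h_signature L" "X \<in> Ob L" "tag L X = IsoSym K"
  shows "card (sorts_below L K) < card (sorts_below L X)"
proof -
  have c: "iso_clause L X K" using assms by (simp add: h_signature_def)
  then have "s_arr L K \<in> out L X" by (auto simp: iso_clause_def intro: top_arrow_out)
  from sorts_below_less[OF assms(1,2) this] show ?thesis
    using c by (simp add: iso_clause_def is_arrow_def)
qed

lemma refl_less:
  assumes "h_signature L" "X \<in> Ob L" "tag L X = ReflSym K"
  shows "card (sorts_below L K) < card (sorts_below L X)"
proof -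
  have c: "refl_clause L X K" using assms by (simp add: h_signature_def)
  then obtain E where E: "E \<in> Ob L" "tag L E = IsoSym K" "is_arrow L (r_arr L K) X E"
    by (auto simp: refl_clause_def)
  have "r_arr L K \<in> out L X" using c by (auto simp: refl_clause_def intro: top_arrow_out)
  from sorts_below_less[OF assms(1,2) this] iso_less[OF assms(1) E(1,2)] show ?thesis
    using E by (simp add: is_arrow_def)
qed

lemma trans_less:
  assumes "h_signature L" "X \<in> Ob L" "tag L X = TransSym f"
  shows "card (sorts_below L (Dom L f)) < card (sorts_below L X)"
proof -
  have c: "trans_clause L X f" using assms by (simp add: h_signature_def)
  then have "arr1 L f \<in> out L X" by (auto simp: trans_clause_def Let_def intro: top_arrow_out)
  from sorts_below_less[OF assms(1,2) this] show ?thesis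
    using c by (simp add: trans_clause_def Let_def is_arrow_def)
qed

text \<open>
  \<open>sort_type L c K x\<close> is the type denoted by \<open>K(x)\<close> when the component of a non-logical sort
  \<open>K'\<close> is the term \<open>c K'\<close> and the argument at \<open>f\<close> in \<open>K // L\<close> is the term \<open>x f\<close>.  It
  serves both for the domains of the components of a structure, where \<open>c\<close> and \<open>x\<close> are
  variables, and for the interpretation of sorts, where \<open>c\<close> gives projections of the structure.

  In the case of a transport sort for \<open>f\<close>, the family along which one transports varies
  the argument at the position \<open>f\<close> of \<open>A\<close>, and only that one: the same
  variable may also occur as an argument of \<open>A\<close> at another position.

  Values on arguments that do not belong to an h-signature are irrelevant; the guard is there for
  termination.
\<close>

function sort_type :: "('o, 'a) signature \<Rightarrow> ('o \<Rightarrow> exp) \<Rightarrow> 'o \<Rightarrow> ('a \<Rightarrow> exp) \<Rightarrow> exp" where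
  "sort_type L c K x =
     (if h_signature L \<and> K \<in> Ob L then
        (case tag L K of
           NonLogical \<Rightarrow> El_h (hlev L K) (foldl EApp (c K) (map x (out_list L K)))
         | IsoSym K' \<Rightarrow>
             (let s = s_arr L K'; t = t_arr L K' in
              EId (sort_type L c K' (\<lambda>p. x (Cmp L p s))) (x s) (x t))
         | ReflSym K' \<Rightarrow>
             (let s = s_arr L K'; t = t_arr L K'; r = r_arr L K' in
              EId (EId (sort_type L c K' (\<lambda>p. x (Cmp L (Cmp L p s) r))) (x (Cmp L s r)) (x (Cmp L t r)))
                  (x r) (ERefl (x (Cmp L s r))))
         | TransSym f \<Rightarrow>
             (let A = Dom L f; f1 = arr1 L f; f2 = arr2 L f; e = e_arr L f in
              EId (sort_type L c A (\<lambda>p. x (Cmp L p f2)))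
                  (x f2)
                  (transport
                     (sort_type L (\<lambda>K. lift (c K)) A
                        (\<lambda>p. if p = f then EVar 0 else lift (x (Cmp L p f1))))
                     (x (Cmp L f f1)) (x (Cmp L f f2)) (x e) (x f1))))
      else undefined)"
  by pat_completeness auto
termination
  by (relation "measure (\<lambda>(L, c, K, x). card (sorts_below L K))")
     (auto intro: iso_less refl_less trans_less)

text \<open>
  The telescope of products over the arrows \<open>fs\<close>, ending in the universe of types of h-level \<open>m\<close>;
  \<open>x\<close> assigns to the arrows treated so far the variables named by them.
\<close>

fun pi_tel :: "('o, 'a) signature \<Rightarrow> ('o \<Rightarrow> exp) \<Rightarrow> ('a \<Rightarrow> exp) \<Rightarrow> 'a list \<Rightarrow> enat \<Rightarrow> exp" where
  "pi_tel L c x [] m = U_h m"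
| "pi_tel L c x (f # fs) m =
     EPi (sort_type L c (Cod L f) (\<lambda>p. x (Cmp L p f)))
         (pi_tel L (\<lambda>K. lift (c K)) ((\<lambda>g. lift (x g))(f := EVar 0)) fs m)"

definition component_type :: "('o, 'a) signature \<Rightarrow> ('o \<Rightarrow> exp) \<Rightarrow> 'o \<Rightarrow> exp" where
  "component_type L c K = pi_tel L c (\<lambda>_. undefined) (out_list L K) (hlev L K)"

fun struc_tel :: "('o, 'a) signature \<Rightarrow> ('o \<Rightarrow> exp) \<Rightarrow> 'o list \<Rightarrow> exp" where
  "struc_tel L c [] = EOne"
| "struc_tel L c [K] = component_type L c K"
| "struc_tel L c (K # K' # Ks) =
     ESig (component_type L c K) (struc_tel L ((\<lambda>A. lift (c A))(K := EVar 0)) (K' # Ks))"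

definition HStruc :: "('o, 'a) signature \<Rightarrow> exp" where
  "HStruc L = struc_tel L (\<lambda>_. undefined) (nonlogical_list L)"

text \<open>The projections to the components \<open>Ks\<close> of a term \<open>M\<close> of an iterated sum type.\<close>

fun components :: "'o list \<Rightarrow> exp \<Rightarrow> exp \<Rightarrow> 'o \<Rightarrow> exp" where
  "components [] T M = (\<lambda>_. undefined)"
| "components [K] T M = (\<lambda>_. undefined)(K := M)"
| "components (K # K' # Ks) (ESig A B) M =
     (components (K' # Ks) (inst B (proj1 A M)) (proj2 A B M))(K := proj1 A M)"
| "components (K # K' # Ks) T M = (\<lambda>_. undefined)"

fun var_index :: "('o, 'a) lctx \<Rightarrow> var \<Rightarrow> nat" where
  "var_index [] x = 0"
| "var_index ((y, S) # \<Gamma>) x = (if x = y then 0 else Suc (var_index \<Gamma> x))"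

text \<open>The structure is the outermost variable of the interpreted context, hence has index \<open>length \<Gamma>\<close>.\<close>

fun interp_sort :: "('o, 'a) signature \<Rightarrow> ('o, 'a) lctx \<Rightarrow> ('o, 'a) sort_exp \<Rightarrow> exp" where
  "interp_sort L \<Gamma> (Sort K x) =
     sort_type L (components (nonlogical_list L) (HStruc L) (EVar (length \<Gamma>))) K
       (\<lambda>f. EVar (var_index \<Gamma> (x f)))"

fun interp_formula :: "('o, 'a) signature \<Rightarrow> ('o, 'a) lctx \<Rightarrow> ('o, 'a) formula \<Rightarrow> exp" where
  "interp_formula L \<Gamma> Falsum = EZero"
| "interp_formula L \<Gamma> Verum = EOne"
| "interp_formula L \<Gamma> (Conj \<phi> \<psi>) = ETimes (interp_formula L \<Gamma> \<phi>) (interp_formula L \<Gamma> \<psi>)"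
| "interp_formula L \<Gamma> (Disj \<phi> \<psi>) = ETrunc (ESum (interp_formula L \<Gamma> \<phi>) (interp_formula L \<Gamma> \<psi>))"
| "interp_formula L \<Gamma> (Impl \<phi> \<psi>) = EArr (interp_formula L \<Gamma> \<phi>) (interp_formula L \<Gamma> \<psi>)"
| "interp_formula L \<Gamma> (Forall x S \<phi>) =
     EPi (interp_sort L \<Gamma> S) (interp_formula L ((x, S) # \<Gamma>) \<phi>)"
| "interp_formula L \<Gamma> (Exists x S \<phi>) =
     ETrunc (ESig (interp_sort L \<Gamma> S) (interp_formula L ((x, S) # \<Gamma>) \<phi>))"

fun interp_ctx :: "('o, 'a) signature \<Rightarrow> ('o, 'a) lctx \<Rightarrow> hctx" where
  "interp_ctx L [] = [HStruc L]"
| "interp_ctx L ((x, S) # \<Gamma>) = interp_sort L \<Gamma> S # interp_ctx L \<Gamma>"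

fun interp_body :: "('o, 'a) signature \<Rightarrow> ('o, 'a) lctx \<Rightarrow> ('o, 'a) lbody \<Rightarrow> hbody" where
  "interp_body L \<Gamma> (IsSort S) = IsType (interp_sort L \<Gamma> S)"
| "interp_body L \<Gamma> (HasSort x S) = HasType (EVar (var_index \<Gamma> x)) (interp_sort L \<Gamma> S)"
| "interp_body L \<Gamma> (IsFormula \<phi>) = IsType (interp_formula L \<Gamma> \<phi>)"

fun interp :: "('o, 'a) signature \<Rightarrow> ('o, 'a) ljudgement \<Rightarrow> hjudgement" where
  "interp L (LCtx \<Gamma>) = HCtx (interp_ctx L \<Gamma>)"
| "interp L (LEnt \<Gamma> J) = HEnt (interp_ctx L \<Gamma>) (interp_body L \<Gamma> J)"

end

theory Submission
  imports Defs
begin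

text \<open>
  The interpretation of a sort depends only on the components below it and on the arguments
  indexed by its arrows, and it commutes with substitution. Hence it is a well-formed type, by
  induction along the arrows of the inverse category: for a logical sort the equations between
  composites in its defining clause are exactly what makes the endpoints of the identity type have
  the same type. For a transport sort, \<open>f\<close> being top-level ensures that replacing the
  argument at \<open>f\<close> affects the type of no other argument. The type of structures is
  therefore closed and well-formed, and the theorem follows by induction on derivations, where
  weakening is a renaming of de Bruijn indices.
\<close>

section \<open>Renaming and substitution\<close>

text \<open>Components and arguments enter \<open>sort_type\<close> as total functions,
  \<open>c\<close> on sorts and \<open>x\<close> on arrows. Its properties are proved for arbitrary
  such functions, so one typing lemma covers both uses: inside \<open>HStruc\<close>, where they
  consist of bound variables, and in the interpretation, where \<open>c\<close> consists of
  projections of the structure. The price is that values off the relevant sorts and arrows are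
  arbitrary terms, which a substitution may change; so equality of functions is replaced by
  agreement on the arrows out of a sort and on the non-logical sorts at or below it.

  The calculus is used without inversion or presupposition theorems: that the parts of a derivable
  judgement are well-formed is never read off from its derivation. The typing lemmas therefore
  assume it explicitly, and the induction on derivations carries it as an invariant.

  The syntax has named variables, which a quantifier may shadow, while the type theory has indices.
  The two are related by index maps that are controlled only on the free variables of the expression
  at hand.\<close>

lemma upr_simps [simp]: "upr \<rho> 0 = 0" "upr \<rho> (Suc n) = Suc (\<rho> n)"
  by (simp_all add: upr_def)

lemma scons_simps [simp]: "(t \<bullet> \<sigma>) 0 = t" "(t \<bullet> \<sigma>) (Suc n) = \<sigma> n"
  by (simp_all add: scons_def)

lemma up_simps [simp]: "up \<sigma> 0 = EVar 0" "up \<sigma> (Suc n) = lift (\<sigma> n)"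
  by (simp_all add: up_def)

lemma up_EVar_comp: "up (\<lambda>n. EVar (\<rho> n)) = (\<lambda>n. EVar (upr \<rho> n))"
proof
  fix n show "up (\<lambda>n. EVar (\<rho> n)) n = EVar (upr \<rho> n)" by (cases n) auto
qed

lemma up_EVar [simp]: "up EVar = EVar"
proof
  fix n show "up EVar n = EVar n" by (cases n) auto
qed

text \<open>The structural rules of \<open>hott\<close> are stated with \<open>sub\<close>, but many
  type formers with \<open>lift\<close>; this lets one theory of substitution serve both.\<close>

lemma ren_eq_sub: "ren \<rho> t = sub (\<lambda>n. EVar (\<rho> n)) t"
  by (induction t arbitrary: \<rho>) (simp_all add: up_EVar_comp)

lemma sub_EVar [simp]: "sub EVar t = t"
  by (induction t) simp_all

lemma up_comp_upr: "(\<lambda>n. up \<sigma> (upr \<rho> n)) = up (\<lambda>n. \<sigma> (\<rho> n))"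
proof
  fix n show "up \<sigma> (upr \<rho> n) = up (\<lambda>n. \<sigma> (\<rho> n)) n" by (cases n) auto
qed

text \<open>First of four fusion laws, whose order matters: moving a composite of two substitutions
  under a binder already needs the laws in which one of the two is a renaming.\<close>

lemma sub_ren: "sub \<sigma> (ren \<rho> t) = sub (\<lambda>n. \<sigma> (\<rho> n)) t"
  by (induction t arbitrary: \<sigma> \<rho>) (simp_all add: up_comp_upr)

lemma ren_ren: "ren \<sigma> (ren \<rho> t) = ren (\<lambda>n. \<sigma> (\<rho> n)) t"
  by (simp add: ren_eq_sub[of \<sigma>] sub_ren) (simp add: ren_eq_sub)

lemma up_ren_comp: "(\<lambda>n. ren (upr \<rho>) (up \<sigma> n)) = up (\<lambda>n. ren \<rho> (\<sigma> n))"
proof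
  fix n show "ren (upr \<rho>) (up \<sigma> n) = up (\<lambda>n. ren \<rho> (\<sigma> n)) n"
    by (cases n) (auto simp: ren_ren)
qed

lemma ren_sub: "ren \<rho> (sub \<sigma> t) = sub (\<lambda>n. ren \<rho> (\<sigma> n)) t"
  by (induction t arbitrary: \<sigma> \<rho>) (simp_all add: up_ren_comp)

lemma up_sub_comp: "(\<lambda>n. sub (up \<tau>) (up \<sigma> n)) = up (\<lambda>n. sub \<tau> (\<sigma> n))"
proof
  fix n show "sub (up \<tau>) (up \<sigma> n) = up (\<lambda>n. sub \<tau> (\<sigma> n)) n"
    by (cases n) (auto simp: ren_sub sub_ren)
qed

lemma sub_sub: "sub \<tau> (sub \<sigma> t) = sub (\<lambda>n. sub \<tau> (\<sigma> n)) t"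
  by (induction t arbitrary: \<sigma> \<tau>) (simp_all add: up_sub_comp)

lemma sub_lift: "sub (up \<sigma>) (lift t) = lift (sub \<sigma> t)"
  by (simp add: sub_ren ren_sub)

lemma sub_scons_lift [simp]: "sub (a \<bullet> \<sigma>) (lift t) = sub \<sigma> t"
  by (simp add: sub_ren)

lemma inst_lift [simp]: "inst (lift t) a = t"
  by (simp add: inst_def)

lemma inst_EVar_0 [simp]: "inst (EVar 0) a = a"
  by (simp add: inst_def)

lemma sub_inst: "sub \<sigma> (inst B a) = inst (sub (up \<sigma>) B) (sub \<sigma> a)"
proof -
  have "(\<lambda>n. sub \<sigma> ((a \<bullet> EVar) n)) = (\<lambda>n. sub (sub \<sigma> a \<bullet> EVar) (up \<sigma> n))"
  proof
    fix n show "sub \<sigma> ((a \<bullet> EVar) n) = sub (sub \<sigma> a \<bullet> EVar) (up \<sigma> n)" by (cases n) auto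
  qed
  then show ?thesis by (simp add: inst_def sub_sub)
qed

text \<open>The shifts \<open>k\<close> and \<open>j\<close> are separate because
  \<open>\<tau>\<close> may keep the \<open>k\<close> new variables (then \<open>j = k\<close>) or
  replace them by terms of another context: \<open>proj2_type\<close> uses \<open>k = 1\<close> with
  \<open>j = 2\<close> and with \<open>j = 0\<close>.\<close>

lemma sub_reinst:
  assumes "\<And>n. \<tau> (n + k) = ren (\<lambda>n. n + j) (\<sigma> n)"
  shows "sub \<tau> (reinst k u C) = reinst j (sub \<tau> u) (sub (up \<sigma>) C)"
proof -
  have "sub \<tau> ((u \<bullet> (\<lambda>n. EVar (n + k))) n) =
      sub (sub \<tau> u \<bullet> (\<lambda>n. EVar (n + j))) (up \<sigma> n)" for n
    using assms by (cases n) (simp_all add: ren_eq_sub sub_sub)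
  then show ?thesis by (simp add: reinst_def sub_sub)
qed

lemma sub_EArr: "sub \<sigma> (EArr A B) = EArr (sub \<sigma> A) (sub \<sigma> B)"
  by (simp add: EArr_def sub_lift)

lemma sub_proj1: "sub \<sigma> (proj1 A p) = proj1 (sub \<sigma> A) (sub \<sigma> p)"
  by (simp add: proj1_def sub_lift)

lemma sub_proj2: "sub \<sigma> (proj2 A B p) = proj2 (sub \<sigma> A) (sub (up \<sigma>) B) (sub \<sigma> p)"
proof -
  have "sub (up \<sigma>) (reinst 1 (proj1 (lift A) (EVar 0)) B) =
      reinst 1 (sub (up \<sigma>) (proj1 (lift A) (EVar 0))) (sub (up \<sigma>) B)"
    by (rule sub_reinst) simp
  then show ?thesis by (simp add: proj2_def sub_proj1 sub_lift)
qed

lemma sub_transport: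
  "sub \<sigma> (transport C a b p u) =
     transport (sub (up \<sigma>) C) (sub \<sigma> a) (sub \<sigma> b) (sub \<sigma> p) (sub \<sigma> u)"
proof -
  have "up (up (up \<sigma>)) (n + 3) = ren (\<lambda>n. n + 3) (\<sigma> n)" for n
    by (simp add: numeral_3_eq_3 ren_ren)
  then have "sub (up (up (up \<sigma>))) (reinst 3 u C) =
      reinst 3 (sub (up (up (up \<sigma>))) u) (sub (up \<sigma>) C)" for u
    by (rule sub_reinst)
  then show ?thesis
    by (simp add: transport_def sub_EArr numeral_2_eq_2)
qed

lemma sub_is_hlevel: "sub \<sigma> (is_hlevel n A) = is_hlevel n (sub \<sigma> A)"
  by (induction n arbitrary: \<sigma> A) (simp_all add: is_contr_def sub_lift)

lemma sub_U_h: "sub \<sigma> (U_h m) = U_h m"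
  by (cases m) (simp_all add: U_h_def sub_is_hlevel)

lemma sub_El_h: "sub \<sigma> (El_h m t) = El_h m (sub \<sigma> t)"
  by (cases m) (simp_all add: El_h_def sub_proj1)

lemma sub_foldl_EApp: "sub \<sigma> (foldl EApp t ts) = foldl EApp (sub \<sigma> t) (map (sub \<sigma>) ts)"
  by (induction ts arbitrary: t) simp_all

lemma up_funpow_EVar: "(up ^^ k) (\<lambda>n. EVar (\<rho> n)) = (\<lambda>n. EVar ((upr ^^ k) \<rho> n))"
  by (induction k) (simp_all add: up_EVar_comp)

section \<open>Derived rules of the type theory\<close>

lemma weaken_type:
  "\<lbrakk>hott (HEnt \<Gamma> (IsType A)); hott (HEnt \<Gamma> (IsType B))\<rbrakk> \<Longrightarrow> hott (HEnt (A # \<Gamma>) (IsType (lift B)))"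
  using weaken[of \<Gamma> A "[]" "IsType B"] by (simp add: ren_eq_sub)

lemma weaken_term:
  "\<lbrakk>hott (HEnt \<Gamma> (IsType A)); hott (HEnt \<Gamma> (HasType b B))\<rbrakk>
    \<Longrightarrow> hott (HEnt (A # \<Gamma>) (HasType (lift b) (lift B)))"
  using weaken[of \<Gamma> A "[]" "HasType b B"] by (simp add: ren_eq_sub)

lemma weaken_type_1:
  assumes "hott (HEnt \<Gamma> (IsType A))" "hott (HEnt (B # \<Gamma>) (IsType C))"
  shows "hott (HEnt (lift B # A # \<Gamma>) (IsType (ren (upr Suc) C)))"
  using weaken[of \<Gamma> A "[B]" "IsType C"] assms by (simp add: ren_eq_sub up_EVar_comp)

lemma subst_type:
  "\<lbrakk>hott (HEnt \<Gamma> (HasType a A)); hott (HEnt (A # \<Gamma>) (IsType B))\<rbrakk>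
    \<Longrightarrow> hott (HEnt \<Gamma> (IsType (inst B a)))"
  using subst[of \<Gamma> a A "[]" "IsType B"] by (simp add: inst_def)

lemma var_0: "hott (HCtx (A # \<Gamma>)) \<Longrightarrow> hott (HEnt (A # \<Gamma>) (HasType (EVar 0) (lift A)))"
  using var[of "A # \<Gamma>" 0] by simp

lemma var_1: "hott (HCtx (A # B # \<Gamma>)) \<Longrightarrow> hott (HEnt (A # B # \<Gamma>) (HasType (EVar 1) (lift (lift B))))"
  using var[of "A # B # \<Gamma>" 1] by (simp add: ren_ren)

lemma var_0_type: "hott (HEnt \<Gamma> (IsType A)) \<Longrightarrow> hott (HEnt (A # \<Gamma>) (HasType (EVar 0) (lift A)))"
  by (intro var_0 ctx_extend)

text \<open>This is the last entry of the context x, y, p in which the motive of \<open>EJ\<close>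
  lives; h-levels use the same type.\<close>

lemma id_type_2:
  assumes "hott (HEnt \<Gamma> (IsType A))"
  shows "hott (HEnt (lift A # A # \<Gamma>) (IsType (EId (lift (lift A)) (EVar 1) (EVar 0))))"
  using assms weaken_type[OF assms assms]
  by (intro id_form weaken_type var_1 var_0 ctx_extend)

lemma is_hlevel_type:
  "hott (HEnt \<Gamma> (IsType A)) \<Longrightarrow> hott (HEnt \<Gamma> (IsType (is_hlevel n A)))"
proof (induction n arbitrary: \<Gamma> A)
  case 0
  then show ?case
    unfolding is_hlevel.simps is_contr_def
    by (intro sig_form pi_form weaken_type id_type_2)
next
  case (Suc n)
  from Suc.IH[OF id_type_2[OF Suc.prems]] Suc.prems show ?case
    by (simp add: pi_form weaken_type)
qed

lemma proj1_type:
  assumes A: "hott (HEnt \<Gamma> (IsType A))" and B: "hott (HEnt (A # \<Gamma>) (IsType B))"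
    and p: "hott (HEnt \<Gamma> (HasType p (ESig A B)))"
  shows "hott (HEnt \<Gamma> (HasType (proj1 A p) A))"
proof -
  have "hott (HEnt (B # A # \<Gamma>) (HasType (EVar 1) (reinst 2 (EPair (EVar 1) (EVar 0)) (lift A))))"
    using var_1[OF ctx_extend[OF B]]
    by (simp add: reinst_def ren_eq_sub sub_sub)
  from sig_ind[OF weaken_type[OF sig_form[OF A B] A] this p] show ?thesis
    by (simp add: proj1_def)
qed

lemma proj1_beta:
  assumes A: "hott (HEnt \<Gamma> (IsType A))" and B: "hott (HEnt (A # \<Gamma>) (IsType B))"
    and a: "hott (HEnt \<Gamma> (HasType a A))" and b: "hott (HEnt \<Gamma> (HasType b (inst B a)))"
  shows "hott (HEnt \<Gamma> (TermEq (proj1 A (EPair a b)) a A))"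
proof -
  have "hott (HEnt (B # A # \<Gamma>) (HasType (EVar 1) (reinst 2 (EPair (EVar 1) (EVar 0)) (lift A))))"
    using var_1[OF ctx_extend[OF B]]
    by (simp add: reinst_def ren_eq_sub sub_sub)
  from sig_beta[OF weaken_type[OF sig_form[OF A B] A] this a b] show ?thesis
    by (simp add: proj1_def)
qed

text \<open>The motive mentions \<open>proj1\<close> of the eliminated pair. In the branch the
  second variable y has type B at x, whereas B at \<open>proj1\<close> of the pair (x, y) is
  required; \<open>proj1_beta\<close> makes the two judgementally equal.\<close>

lemma proj2_type:
  assumes A: "hott (HEnt \<Gamma> (IsType A))" and B: "hott (HEnt (A # \<Gamma>) (IsType B))"
    and p: "hott (HEnt \<Gamma> (HasType p (ESig A B)))"
  shows "hott (HEnt \<Gamma> (HasType (proj2 A B p) (inst B (proj1 A p))))"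
proof -
  let ?S = "ESig A B" and ?C = "reinst 1 (proj1 (lift A) (EVar 0)) B"
  have S: "hott (HEnt \<Gamma> (IsType ?S))" using A B by (rule sig_form)
  have lA: "hott (HEnt (?S # \<Gamma>) (IsType (lift A)))" by (rule weaken_type[OF S A])
  have lB: "hott (HEnt (lift A # ?S # \<Gamma>) (IsType (ren (upr Suc) B)))"
    by (rule weaken_type_1[OF S B])
  have "hott (HEnt (?S # \<Gamma>) (HasType (EVar 0) (ESig (lift A) (ren (upr Suc) B))))"
    using var_0_type[OF S] by simp
  from subst_type[OF proj1_type[OF lA lB this] lB]
  have "hott (HEnt (?S # \<Gamma>) (IsType (inst (ren (upr Suc) B) (proj1 (lift A) (EVar 0)))))" .
  moreover have "inst (ren (upr Suc) B) a = reinst 1 a B" for a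
  proof -
    have "(\<lambda>n. (a \<bullet> EVar) (upr Suc n)) = a \<bullet> (\<lambda>n. EVar (n + 1))"
    proof
      fix n show "(a \<bullet> EVar) (upr Suc n) = (a \<bullet> (\<lambda>n. EVar (n + 1))) n" by (cases n) auto
    qed
    then show ?thesis by (simp add: inst_def reinst_def sub_ren)
  qed
  ultimately have C: "hott (HEnt (?S # \<Gamma>) (IsType ?C))" by simp
  \<comment> \<open>Copies of \<open>A\<close> and \<open>B\<close> in the branch context
    \<open>B # A # \<Gamma>\<close>, so that \<open>proj1_beta\<close> applies to the pair of its
    two variables.\<close>
  let ?A2 = "lift (lift A)" and ?B2 = "ren (upr Suc) (ren (upr Suc) B)"
  have AA: "hott (HEnt (A # \<Gamma>) (IsType (lift A)))" by (rule weaken_type[OF A A])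
  have BA: "hott (HEnt (lift A # A # \<Gamma>) (IsType (ren (upr Suc) B)))" by (rule weaken_type_1[OF A B])
  have A2: "hott (HEnt (B # A # \<Gamma>) (IsType ?A2))" by (rule weaken_type[OF B AA])
  have B2: "hott (HEnt (?A2 # B # A # \<Gamma>) (IsType ?B2))" by (rule weaken_type_1[OF B BA])
  have v1: "hott (HEnt (B # A # \<Gamma>) (HasType (EVar 1) ?A2))" by (rule var_1[OF ctx_extend[OF B]])
  have "inst ?B2 (EVar 1) = lift B"
  proof -
    have "(\<lambda>n. (EVar 1 \<bullet> EVar) (upr Suc (upr Suc n))) = (\<lambda>n. EVar (Suc n))"
    proof
      fix n show "(EVar 1 \<bullet> EVar) (upr Suc (upr Suc n)) = EVar (Suc n)" by (cases n) auto
    qed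
    then show ?thesis by (simp add: inst_def sub_ren) (simp add: ren_eq_sub)
  qed
  then have v0: "hott (HEnt (B # A # \<Gamma>) (HasType (EVar 0) (inst ?B2 (EVar 1))))"
    using var_0_type[OF B] by simp
  have "inst ?B2 (proj1 ?A2 (EPair (EVar 1) (EVar 0))) = reinst 2 (EPair (EVar 1) (EVar 0)) ?C"
  proof -
    have "sub (EPair (EVar 1) (EVar 0) \<bullet> (\<lambda>n. EVar (n + 2))) ?C =
      reinst 2 (sub (EPair (EVar 1) (EVar 0) \<bullet> (\<lambda>n. EVar (n + 2))) (proj1 (lift A) (EVar 0))) (sub (up EVar) B)"
      by (rule sub_reinst) simp
    moreover have "inst ?B2 a = reinst 2 a B" for a
    proof -
      have "(\<lambda>n. (a \<bullet> EVar) (upr Suc (upr Suc n))) = a \<bullet> (\<lambda>n. EVar (n + 2))"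
      proof
        fix n show "(a \<bullet> EVar) (upr Suc (upr Suc n)) = (a \<bullet> (\<lambda>n. EVar (n + 2))) n" by (cases n) auto
      qed
      then show ?thesis by (simp add: inst_def reinst_def sub_ren)
    qed
    ultimately show ?thesis
      unfolding reinst_def[of 2 _ ?C] by (simp add: sub_proj1 ren_ren) (simp add: ren_eq_sub)
  qed
  moreover have "hott (HEnt (B # A # \<Gamma>) (TypeEq (inst ?B2 (EVar 1))
       (inst ?B2 (proj1 ?A2 (EPair (EVar 1) (EVar 0))))))"
    by (rule type_sym, rule subst_type_eq[OF proj1_beta[OF A2 B2 v1 v0] B2])
  ultimately have "hott (HEnt (B # A # \<Gamma>) (HasType (EVar 0) (reinst 2 (EPair (EVar 1) (EVar 0)) ?C)))"
    using conv[OF v0] by simp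
  from sig_ind[OF C this p] have "hott (HEnt \<Gamma> (HasType (proj2 A B p) (inst ?C p)))"
    by (simp add: proj2_def)
  moreover have "inst ?C p = inst B (proj1 A p)"
  proof -
    have "sub (p \<bullet> EVar) ?C = reinst 0 (sub (p \<bullet> EVar) (proj1 (lift A) (EVar 0))) (sub (up EVar) B)"
      by (rule sub_reinst) simp
    then show ?thesis by (simp add: inst_def reinst_def sub_proj1)
  qed
  ultimately show ?thesis by simp
qed

lemma transport_type:
  assumes A: "hott (HEnt \<Gamma> (IsType A))" and C: "hott (HEnt (A # \<Gamma>) (IsType C))"
    and a: "hott (HEnt \<Gamma> (HasType a A))" and b: "hott (HEnt \<Gamma> (HasType b A))"
    and p: "hott (HEnt \<Gamma> (HasType p (EId A a b)))"
    and u: "hott (HEnt \<Gamma> (HasType u (inst C a)))"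
  shows "hott (HEnt \<Gamma> (HasType (transport C a b p u) (inst C b)))"
proof -
  let ?C2 = "reinst 3 (EVar 2) C" and ?C1 = "reinst 3 (EVar 1) C"
  let ?I = "EId (lift (lift A)) (EVar 1) (EVar 0)"
  have AA: "hott (HEnt (A # \<Gamma>) (IsType (lift A)))" by (rule weaken_type[OF A A])
  have I: "hott (HEnt (lift A # A # \<Gamma>) (IsType ?I))" by (rule id_type_2[OF A])
  \<comment> \<open>The variable x is the one that \<open>C\<close> binds already, so C at x over x,
    y, p is plain weakening by y and p.\<close>
  have "lift (lift C) = ?C2"
  proof -
    have "(\<lambda>n. EVar (Suc (Suc n))) = EVar 2 \<bullet> (\<lambda>n. EVar (n + 3))"
    proof
      fix n show "EVar (Suc (Suc n)) = (EVar 2 \<bullet> (\<lambda>n. EVar (n + 3))) n" by (cases n) auto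
    qed
    then show ?thesis by (simp add: reinst_def ren_ren) (simp add: ren_eq_sub)
  qed
  then have C2: "hott (HEnt (?I # lift A # A # \<Gamma>) (IsType ?C2))"
    using weaken_type[OF I weaken_type[OF AA C]] by simp
  \<comment> \<open>Here y becomes the variable bound by \<open>C\<close>: x is inserted behind it,
    and p is added in front.\<close>
  have "lift (ren (upr Suc) C) = ?C1"
  proof -
    have "(\<lambda>n. EVar (Suc (upr Suc n))) = EVar 1 \<bullet> (\<lambda>n. EVar (n + 3))"
    proof
      fix n show "EVar (Suc (upr Suc n)) = (EVar 1 \<bullet> (\<lambda>n. EVar (n + 3))) n" by (cases n) auto
    qed
    then show ?thesis by (simp add: reinst_def ren_ren) (simp add: ren_eq_sub)
  qed
  then have C1: "hott (HEnt (?I # lift A # A # \<Gamma>) (IsType ?C1))"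
    using weaken_type[OF I weaken_type_1[OF A C]] by simp
  have M: "hott (HEnt (?I # lift A # A # \<Gamma>) (IsType (EArr ?C2 ?C1)))"
    unfolding EArr_def by (intro pi_form C2 weaken_type[OF C2 C1])
  let ?r = "ERefl (EVar 0) \<bullet> EVar 0 \<bullet> EVar 0 \<bullet> (\<lambda>n. EVar (Suc n))"
  have re: "sub \<tau> (reinst 3 w C) = sub (sub \<tau> w \<bullet> (\<lambda>n. \<tau> (n + 3))) C" for \<tau> w
  proof -
    have "(\<lambda>n. sub \<tau> ((w \<bullet> (\<lambda>n. EVar (n + 3))) n)) = sub \<tau> w \<bullet> (\<lambda>n. \<tau> (n + 3))"
    proof
      fix n show "sub \<tau> ((w \<bullet> (\<lambda>n. EVar (n + 3))) n) = (sub \<tau> w \<bullet> (\<lambda>n. \<tau> (n + 3))) n"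
        by (cases n) auto
    qed
    then show ?thesis by (simp add: reinst_def sub_sub)
  qed
  have "EVar 0 \<bullet> (\<lambda>n. EVar (Suc n)) = EVar"
  proof
    fix n show "(EVar 0 \<bullet> (\<lambda>n. EVar (Suc n))) n = EVar n" by (cases n) auto
  qed
  \<comment> \<open>On the diagonal source and target of the motive are both \<open>C\<close>, so
    the identity function is the branch.\<close>
  then have "sub ?r ?C2 = C" "sub ?r ?C1 = C"
    unfolding re by (simp_all add: numeral_2_eq_2 numeral_3_eq_3)
  then have "hott (HEnt (A # \<Gamma>) (HasType (ELam C (EVar 0)) (sub ?r (EArr ?C2 ?C1))))"
    unfolding sub_EArr using lam[OF C var_0_type[OF C]] by (simp add: EArr_def)
  from id_ind[OF M this a b p]
  have "hott (HEnt \<Gamma> (HasType (EJ (EArr ?C2 ?C1) (ELam C (EVar 0)) a b p) (EArr (inst C a) (inst C b))))"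
    unfolding sub_EArr re by (simp add: inst_def numeral_2_eq_2 numeral_3_eq_3)
  from app[OF this[unfolded EArr_def[of "inst C a"]] u] show ?thesis
    by (simp add: transport_def)
qed

lemma U_h_type: "hott (HCtx \<Gamma>) \<Longrightarrow> hott (HEnt \<Gamma> (IsType (U_h m)))"
  using el_form[of "EU # \<Gamma>" "EVar 0"] var_0_type[OF univ_form, of \<Gamma>]
  by (cases m) (auto simp: U_h_def intro: sig_form univ_form is_hlevel_type)

lemma El_h_type:
  assumes "hott (HCtx \<Gamma>)" "hott (HEnt \<Gamma> (HasType t (U_h m)))"
  shows "hott (HEnt \<Gamma> (IsType (El_h m t)))"
proof (cases m)
  case (enat n)
  have "hott (HEnt (EU # \<Gamma>) (IsType (is_hlevel n (EEl (EVar 0)))))"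
    using el_form[of "EU # \<Gamma>" "EVar 0"] var_0_type[OF univ_form[OF assms(1)]]
    by (simp add: is_hlevel_type)
  from proj1_type[OF univ_form[OF assms(1)] this] assms(2) enat
  show ?thesis by (simp add: El_h_def U_h_def el_form)
qed (use assms in \<open>simp add: El_h_def U_h_def el_form\<close>)

section \<open>Arrows and dependencies of sorts\<close>

lemma strict_linear_sorted_list_exists:
  "\<lbrakk>finite S; strict_linear_on S lt\<rbrakk> \<Longrightarrow> \<exists>xs. sorted_wrt lt xs \<and> distinct xs \<and> set xs = S"
proof (induction "card S" arbitrary: S)
  case 0
  then show ?case by (intro exI[of _ "[]"]) auto
next
  case (Suc n)
  have irr: "\<not> lt x x" if "x \<in> S" for x
    using Suc.prems(2) that by (simp add: strict_linear_on_def)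
  have tr: "lt x z" if "lt x y" "lt y z" "x \<in> S" "y \<in> S" "z \<in> S" for x y z
    using Suc.prems(2) that unfolding strict_linear_on_def by metis
  have tot: "lt x y \<or> lt y x" if "x \<noteq> y" "x \<in> S" "y \<in> S" for x y
    using Suc.prems(2) that by (simp add: strict_linear_on_def)
  have "S \<noteq> {}" using Suc.hyps(2) by auto
  moreover have "asymp_on S lt" "transp_on S lt"
    using irr tr by (blast intro: asymp_onI transp_onI)+
  ultimately obtain m where m: "m \<in> S" "\<And>y. \<lbrakk>y \<in> S; y \<noteq> m\<rbrakk> \<Longrightarrow> lt m y"
    using Finite_Set.bex_min_element[OF Suc.prems(1), of lt] tot by metis
  have "n = card (S - {m})" "finite (S - {m})" using Suc.hyps(2) Suc.prems(1) m(1) by auto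
  moreover have "strict_linear_on (S - {m}) lt"
    unfolding strict_linear_on_def using irr tr tot by blast
  ultimately obtain xs where "sorted_wrt lt xs" "distinct xs" "set xs = S - {m}"
    using Suc.hyps(1) by blast
  with m show ?case by (intro exI[of _ "m # xs"]) auto
qed

lemma strict_linear_sorted_list_unique:
  "\<lbrakk>strict_linear_on S lt; sorted_wrt lt xs; distinct xs; set xs = S;
    sorted_wrt lt ys; distinct ys; set ys = S\<rbrakk> \<Longrightarrow> xs = ys"
proof (induction xs arbitrary: S ys)
  case (Cons a xs)
  then obtain b zs where ys: "ys = b # zs" by (cases ys) auto
  have irr: "\<not> lt x x" if "x \<in> S" for x
    using Cons.prems(1) that by (simp add: strict_linear_on_def)
  have tr: "lt x z" if "lt x y" "lt y z" "x \<in> S" "y \<in> S" "z \<in> S" for x y z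
    using Cons.prems(1) that unfolding strict_linear_on_def by metis
  have tot: "lt x y \<or> lt y x" if "x \<noteq> y" "x \<in> S" "y \<in> S" for x y
    using Cons.prems(1) that by (simp add: strict_linear_on_def)
  have S: "a \<in> S" "b \<in> S" "insert a (set xs) = S" "insert b (set zs) = S"
    "a \<notin> set xs" "b \<notin> set zs" "\<forall>x\<in>set xs. lt a x" "\<forall>x\<in>set zs. lt b x"
    using Cons.prems(2-) by (auto simp: ys)
  \<comment> \<open>Were the heads different, each would occur in the tail of the other list, and
    each would precede the other.\<close>
  have ab: "a = b" using S irr tr by (metis insert_iff)
  have "strict_linear_on (S - {a}) lt"
    unfolding strict_linear_on_def using irr tr tot by blast
  moreover have "set xs = S - {a}" "set zs = S - {a}" using S ab by blast+
  ultimately have "xs = zs" using Cons.IH[of "S - {a}" zs] Cons.prems(2-) ys by simp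
  then show ?case using ys ab by simp
qed auto

text \<open>Gives meaning to the definite descriptions behind \<open>out_list\<close> and
  \<open>nonlogical_list\<close>.\<close>

lemma the_sorted_list:
  assumes "finite S" "strict_linear_on S lt"
  defines "xs \<equiv> (THE xs. sorted_wrt lt xs \<and> distinct xs \<and> set xs = S)"
  shows "sorted_wrt lt xs" "distinct xs" "set xs = S"
proof -
  have "\<exists>!xs. sorted_wrt lt xs \<and> distinct xs \<and> set xs = S"
    using strict_linear_sorted_list_exists[OF assms(1,2)]
      strict_linear_sorted_list_unique[OF assms(2)] by blast
  from theI'[OF this] show "sorted_wrt lt xs" "distinct xs" "set xs = S"
    by (simp_all add: xs_def)
qed

text \<open>Turns "smaller in the order" into "already bound": in a telescope laid out along the
  order, whatever lies below an entry stands in front of it.\<close>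

lemma sorted_prefix_downward_closed:
  assumes "strict_linear_on S lt" "sorted_wrt lt (ds @ f # fs)" "set (ds @ f # fs) = S"
    and "g \<in> S" "lt g f"
  shows "g \<in> set ds"
proof (rule ccontr)
  assume "g \<notin> set ds"
  then have "g = f \<or> lt f g" using assms(2-4) by (auto simp: sorted_wrt_append)
  moreover have "f \<in> S" "\<not> lt f f" using assms(1,3) by (auto simp: strict_linear_on_def)
  ultimately show False using assms(1,4,5) unfolding strict_linear_on_def by blast
qed

text \<open>The sorts whose components can occur in the type denoted by \<open>K\<close>. Logical
  sorts have no component, and \<open>K\<close> itself counts only if it is non-logical.\<close>

definition support :: "('o, 'a) signature \<Rightarrow> 'o \<Rightarrow> 'o set" where
  "support L K = insert K (sorts_below L K) \<inter> nonlogical L"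

declare sort_type.simps [simp del]

locale h_sig =
  fixes L :: "('o, 'a) signature"
  assumes h_sig: "h_signature L"
begin

lemma inverse_cat: "inverse_category L" and proper: "proper_order L"
  using h_sig by (auto simp: h_signature_def FOLDS_signature_def)

lemma cat: "category L"
  using inverse_cat by (simp add: inverse_category_def)

lemma finite_out: "K \<in> Ob L \<Longrightarrow> finite (out L K)"
  using inverse_cat rev_finite_subset[of "{f \<in> Arr L. Dom L f = K}" "out L K"]
  by (auto simp: inverse_category_def out_def)

lemma Cod_Ob: "f \<in> out L K \<Longrightarrow> Cod L f \<in> Ob L"
  using cat by (auto simp: category_def out_def)

lemma oless_Cod: "\<lbrakk>K \<in> Ob L; f \<in> out L K\<rbrakk> \<Longrightarrow> oless L (Cod L f) K"
  using proper by (auto simp: proper_order_def)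

lemma oless_irrefl: "K \<in> Ob L \<Longrightarrow> \<not> oless L K K"
  using proper by (auto simp: proper_order_def strict_linear_on_def)

lemma oless_trans:
  "\<lbrakk>oless L A B; oless L B C; A \<in> Ob L; B \<in> Ob L; C \<in> Ob L\<rbrakk> \<Longrightarrow> oless L A C"
  using proper unfolding proper_order_def strict_linear_on_def by blast

lemma comp_arrow:
  assumes "f \<in> out L K" "g \<in> out L (Cod L f)"
  shows "Cmp L g f \<in> Arr L" "Dom L (Cmp L g f) = K" "Cod L (Cmp L g f) = Cod L g"
  using cat assms by (auto simp: category_def out_def is_arrow_def)

lemma comp_out:
  assumes K: "K \<in> Ob L" and f: "f \<in> out L K" and g: "g \<in> out L (Cod L f)"
  shows "Cmp L g f \<in> out L K"
proof -
  have "oless L (Cod L g) K"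
    using oless_trans[OF oless_Cod[OF Cod_Ob[OF f] g] oless_Cod[OF K f]] Cod_Ob[OF f] Cod_Ob[OF g] K
    by blast
  then have "Cmp L g f \<noteq> Idn L K"
    using comp_arrow[OF f g] oless_irrefl[OF K] cat K by (auto simp: category_def is_arrow_def)
  then show ?thesis using comp_arrow[OF f g] by (simp add: out_def)
qed

lemma comp_assoc:
  assumes "f \<in> out L K" "g \<in> out L (Cod L f)" "k \<in> out L (Cod L g)"
  shows "Cmp L (Cmp L k g) f = Cmp L k (Cmp L g f)"
  using cat assms by (auto simp: category_def out_def)

lemma oless_comp: "\<lbrakk>f \<in> out L K; g \<in> out L (Cod L f)\<rbrakk> \<Longrightarrow> oless L (Cod L (Cmp L g f)) (Cod L f)"
  using oless_Cod[OF Cod_Ob] comp_arrow(3) by metis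

lemma sorts_below_mono:
  assumes "K \<in> Ob L" "f \<in> out L K"
  shows "insert (Cod L f) (sorts_below L (Cod L f)) \<subseteq> sorts_below L K"
proof -
  have "Cod L g \<in> sorts_below L K" if "g \<in> out L (Cod L f)" for g
    using comp_out[OF assms that] comp_arrow(3)[OF assms(2) that]
    unfolding sorts_below_def by (metis imageI)
  then show ?thesis using assms by (auto simp: sorts_below_def)
qed

text \<open>The domains in the product telescope of \<open>K\<close> involve only components
  strictly below \<open>K\<close>; so the type of the component at \<open>K\<close> can be formed
  before that component is available.\<close>

lemma support_below: "\<lbrakk>K \<in> Ob L; f \<in> out L K\<rbrakk> \<Longrightarrow> support L (Cod L f) \<subseteq> sorts_below L K \<inter> nonlogical L"
  using sorts_below_mono by (auto simp: support_def)

lemma support_mono: "\<lbrakk>K \<in> Ob L; f \<in> out L K\<rbrakk> \<Longrightarrow> support L (Cod L f) \<subseteq> support L K"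
  using support_below by (auto simp: support_def)

text \<open>The number of sorts below drops along every arrow out of a sort; this is also the
  measure by which \<open>sort_type\<close> terminates.\<close>

lemma sort_induct [consumes 1, case_names step]:
  assumes "K \<in> Ob L" and "\<And>K. \<lbrakk>K \<in> Ob L; \<And>f. f \<in> out L K \<Longrightarrow> P (Cod L f)\<rbrakk> \<Longrightarrow> P K"
  shows "P K"
  using assms(1)
proof (induction "card (sorts_below L K)" arbitrary: K rule: less_induct)
  case less
  then show ?case using assms(2) sorts_below_less[OF h_sig less.prems] Cod_Ob by blast
qed

lemma out_list: assumes "K \<in> Ob L"
  shows "sorted_wrt (aless L) (out_list L K)" "distinct (out_list L K)" "set (out_list L K) = out L K"
  using the_sorted_list[OF finite_out[OF assms], of "aless L"] proper assms
  by (auto simp: out_list_def proper_order_def)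

text \<open>The codomain of a composite \<open>Cmp L g f\<close> lies below that of
  \<open>f\<close>, so a proper order lists the composite first. Hence the arguments of each domain
  in a product telescope are bound before that domain is reached.\<close>

lemma out_list_prefix:
  assumes K: "K \<in> Ob L" and l: "out_list L K = ds @ f # fs" and g: "g \<in> out L (Cod L f)"
  shows "Cmp L g f \<in> set ds"
proof (rule sorted_prefix_downward_closed)
  show "strict_linear_on (out L K) (aless L)" using proper K by (simp add: proper_order_def)
  show "sorted_wrt (aless L) (ds @ f # fs)" "set (ds @ f # fs) = out L K"
    using out_list[OF K] by (simp_all add: l)
  then have f: "f \<in> out L K" by auto
  show c: "Cmp L g f \<in> out L K" by (rule comp_out[OF K f g])
  show "aless L (Cmp L g f) f"
    using oless_comp[OF f g] c f K proper by (simp add: proper_order_def)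
qed

lemma iso_sort:
  assumes "X \<in> Ob L" "tag L X = IsoSym K"
  shows "s_arr L K \<in> out L X" "t_arr L K \<in> out L X"
    "Cod L (s_arr L K) = K" "Cod L (t_arr L K) = K"
    "g \<in> out L K \<Longrightarrow> Cmp L g (t_arr L K) = Cmp L g (s_arr L K)"
proof -
  have c: "iso_clause L X K" using h_sig assms by (simp add: h_signature_def)
  then show "s_arr L K \<in> out L X" "t_arr L K \<in> out L X"
    by (auto simp: iso_clause_def intro: top_arrow_out)
  show "Cod L (s_arr L K) = K" "Cod L (t_arr L K) = K"
    "g \<in> out L K \<Longrightarrow> Cmp L g (t_arr L K) = Cmp L g (s_arr L K)"
    using c by (auto simp: iso_clause_def is_arrow_def)
qed

lemma refl_sort:
  assumes "X \<in> Ob L" "tag L X = ReflSym K"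
  obtains E where "E \<in> Ob L" "tag L E = IsoSym K" "r_arr L K \<in> out L X" "Cod L (r_arr L K) = E"
    "Cmp L (t_arr L K) (r_arr L K) = Cmp L (s_arr L K) (r_arr L K)"
proof -
  have c: "refl_clause L X K" using h_sig assms by (simp add: h_signature_def)
  then have "r_arr L K \<in> out L X" by (auto simp: refl_clause_def intro: top_arrow_out)
  with c show ?thesis by (auto simp: refl_clause_def is_arrow_def intro: that)
qed

lemma trans_sort:
  assumes "X \<in> Ob L" "tag L X = TransSym f"
  defines "A \<equiv> Dom L f" and "K \<equiv> Cod L f"
  obtains E where "A \<in> Ob L" "f \<in> out L A" "top_level L f"
    "E \<in> Ob L" "tag L E = IsoSym K" "e_arr L f \<in> out L X" "Cod L (e_arr L f) = E"
    "arr1 L f \<in> out L X" "Cod L (arr1 L f) = A" "arr2 L f \<in> out L X" "Cod L (arr2 L f) = A"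
    "Cmp L (s_arr L K) (e_arr L f) = Cmp L f (arr1 L f)"
    "Cmp L (t_arr L K) (e_arr L f) = Cmp L f (arr2 L f)"
    "\<And>g. \<lbrakk>g \<in> out L A; g \<noteq> f\<rbrakk> \<Longrightarrow> Cmp L g (arr1 L f) = Cmp L g (arr2 L f)"
    "\<And>q. q \<in> out L K \<Longrightarrow> Cmp L q (Cmp L f (arr1 L f)) = Cmp L q (Cmp L f (arr2 L f))"
proof -
  have c: "trans_clause L X f" using h_sig assms by (simp add: h_signature_def)
  then have "e_arr L f \<in> out L X" "arr1 L f \<in> out L X" "arr2 L f \<in> out L X"
    by (auto simp: trans_clause_def Let_def intro: top_arrow_out)
  moreover from c have "f \<in> out L A"
    by (auto simp: trans_clause_def Let_def top_level_def nonid_def out_def A_def)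
  moreover then have "A \<in> Ob L" using cat by (auto simp: category_def out_def)
  ultimately show ?thesis using c that
    by (auto simp: trans_clause_def Let_def is_arrow_def A_def K_def)
qed

lemma top_level_comp_neq:
  assumes "top_level L f" "g \<in> out L K" "p \<in> out L (Cod L g)"
  shows "Cmp L p g \<noteq> f"
proof
  assume "Cmp L p g = f"
  moreover have "nonid L p" "nonid L g" "Dom L p = Cod L g"
    using assms(2,3) by (simp_all add: nonid_def out_def)
  ultimately show False using assms(1) unfolding top_level_def by metis
qed

section \<open>The types denoted by sorts\<close>

lemma sort_type_nonlogical:
  "\<lbrakk>K \<in> Ob L; tag L K = NonLogical\<rbrakk> \<Longrightarrow>
     sort_type L c K x = El_h (hlev L K) (foldl EApp (c K) (map x (out_list L K)))"
  by (simp add: sort_type.simps h_sig)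

lemma sort_type_iso:
  "\<lbrakk>X \<in> Ob L; tag L X = IsoSym K\<rbrakk> \<Longrightarrow> sort_type L c X x =
     EId (sort_type L c K (\<lambda>p. x (Cmp L p (s_arr L K)))) (x (s_arr L K)) (x (t_arr L K))"
  by (simp add: sort_type.simps[of L c X] h_sig Let_def)

lemma sort_type_refl:
  "\<lbrakk>X \<in> Ob L; tag L X = ReflSym K\<rbrakk> \<Longrightarrow> sort_type L c X x =
     EId (EId (sort_type L c K (\<lambda>p. x (Cmp L (Cmp L p (s_arr L K)) (r_arr L K))))
            (x (Cmp L (s_arr L K) (r_arr L K))) (x (Cmp L (t_arr L K) (r_arr L K))))
         (x (r_arr L K)) (ERefl (x (Cmp L (s_arr L K) (r_arr L K))))"
  by (simp add: sort_type.simps[of L c X] h_sig Let_def)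

lemma sort_type_trans:
  "\<lbrakk>X \<in> Ob L; tag L X = TransSym f\<rbrakk> \<Longrightarrow> sort_type L c X x =
     EId (sort_type L c (Dom L f) (\<lambda>p. x (Cmp L p (arr2 L f)))) (x (arr2 L f))
       (transport
         (sort_type L (\<lambda>K. lift (c K)) (Dom L f)
            (\<lambda>p. if p = f then EVar 0 else lift (x (Cmp L p (arr1 L f)))))
         (x (Cmp L f (arr1 L f))) (x (Cmp L f (arr2 L f))) (x (e_arr L f)) (x (arr1 L f)))"
  by (simp add: sort_type.simps[of L c X] h_sig Let_def)

text \<open>The clauses of a signature and associativity equate composites only for arrows out of a
  given sort. Argument families identified by them agree there and perhaps nowhere else, and this
  lemma turns such agreement into syntactic equality of types.\<close>

lemma sort_type_cong:
  "\<lbrakk>K \<in> Ob L; \<And>A. A \<in> support L K \<Longrightarrow> c A = c' A; \<And>f. f \<in> out L K \<Longrightarrow> x f = x' f\<rbrakk>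
    \<Longrightarrow> sort_type L c K x = sort_type L c' K x'"
proof (induction K arbitrary: c c' x x' rule: sort_induct)
  case (step X)
  have IH: "sort_type L d (Cod L f) y = sort_type L d' (Cod L f) y'"
    if "f \<in> out L X" "\<And>A. A \<in> support L X \<Longrightarrow> d A = d' A" "\<And>g. g \<in> out L (Cod L f) \<Longrightarrow> y g = y' g"
    for f d d' y y'
    using step.IH[OF that(1), of d d' y y'] support_mono[OF step.hyps that(1)] that by blast
  have comp: "x (Cmp L p g) = x' (Cmp L p g)" if "g \<in> out L X" "p \<in> out L (Cod L g)" for p g
    using step.prems(2) comp_out[OF step.hyps that] by blast
  show ?case
  proof (cases "tag L X")
    case NonLogical
    then have "c X = c' X" using step by (simp add: support_def nonlogical_def)
    moreover have "map x (out_list L X) = map x' (out_list L X)"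
      using step.prems(2) out_list(3)[OF step.hyps] by (intro map_cong) auto
    ultimately show ?thesis by (simp only: sort_type_nonlogical[OF step.hyps NonLogical])
  next
    case (IsoSym K)
    note s = iso_sort[OF step.hyps IsoSym]
    have "sort_type L c K (\<lambda>p. x (Cmp L p (s_arr L K))) = sort_type L c' K (\<lambda>p. x' (Cmp L p (s_arr L K)))"
      by (rule IH[OF s(1), unfolded s(3)]) (use step.prems(1) comp[OF s(1)] s(3) in auto)
    then show ?thesis using s step.prems(2) by (simp add: sort_type_iso[OF step.hyps IsoSym])
  next
    case (ReflSym K)
    then obtain E where E: "E \<in> Ob L" "tag L E = IsoSym K" "r_arr L K \<in> out L X" "Cod L (r_arr L K) = E"
      "Cmp L (t_arr L K) (r_arr L K) = Cmp L (s_arr L K) (r_arr L K)"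
      using refl_sort[OF step.hyps] by blast
    note s = iso_sort[OF E(1,2)]
    have sr: "Cmp L (s_arr L K) (r_arr L K) \<in> out L X" "Cod L (Cmp L (s_arr L K) (r_arr L K)) = K"
      using comp_out[OF step.hyps E(3)] comp_arrow(3)[OF E(3)] E(4) s by auto
    have xx: "x (Cmp L (Cmp L p (s_arr L K)) (r_arr L K)) = x' (Cmp L (Cmp L p (s_arr L K)) (r_arr L K))"
      if "p \<in> out L K" for p
      using comp[OF E(3)] comp_out[OF E(1) s(1)] s(3) E(4) that by auto
    have "sort_type L c K (\<lambda>p. x (Cmp L (Cmp L p (s_arr L K)) (r_arr L K))) =
        sort_type L c' K (\<lambda>p. x' (Cmp L (Cmp L p (s_arr L K)) (r_arr L K)))"
      by (rule IH[OF sr(1), unfolded sr(2)]) (use step.prems(1) xx sr(2) in auto)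
    then show ?thesis using sr E step.prems(2) by (simp add: sort_type_refl[OF step.hyps ReflSym])
  next
    case (TransSym f)
    have A: "Dom L f \<in> Ob L" "f \<in> out L (Dom L f)"
      "e_arr L f \<in> out L X" "arr1 L f \<in> out L X" "Cod L (arr1 L f) = Dom L f"
      "arr2 L f \<in> out L X" "Cod L (arr2 L f) = Dom L f"
      using trans_sort[OF step.hyps TransSym] by metis+
    have 2: "sort_type L c (Dom L f) (\<lambda>p. x (Cmp L p (arr2 L f))) =
       sort_type L c' (Dom L f) (\<lambda>p. x' (Cmp L p (arr2 L f)))"
      by (rule IH[OF A(6), unfolded A(7)]) (use step.prems(1) comp[OF A(6)] A in auto)
    have 1: "sort_type L (\<lambda>K. lift (c K)) (Dom L f)
        (\<lambda>p. if p = f then EVar 0 else lift (x (Cmp L p (arr1 L f)))) =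
      sort_type L (\<lambda>K. lift (c' K)) (Dom L f)
        (\<lambda>p. if p = f then EVar 0 else lift (x' (Cmp L p (arr1 L f))))"
      by (rule IH[OF A(4), unfolded A(5)]) (use step.prems(1) comp[OF A(4)] A in auto)
    show ?thesis using A step.prems(2) comp[OF A(4), of f] comp[OF A(6), of f]
      unfolding sort_type_trans[OF step.hyps TransSym] 1 2 by simp
  qed
qed

lemma sub_sort_type:
  "K \<in> Ob L \<Longrightarrow> sub \<sigma> (sort_type L c K x) = sort_type L (\<lambda>A. sub \<sigma> (c A)) K (\<lambda>f. sub \<sigma> (x f))"
proof (induction K arbitrary: \<sigma> c x rule: sort_induct)
  case (step X)
  show ?case
  proof (cases "tag L X")
    case NonLogical
    then show ?thesis using step.hyps
      by (simp add: sort_type_nonlogical sub_El_h sub_foldl_EApp comp_def)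
  next
    case (IsoSym K)
    note s = iso_sort[OF step.hyps IsoSym]
    show ?thesis using step.IH[OF s(1)] s(3) by (simp add: sort_type_iso[OF step.hyps IsoSym])
  next
    case (ReflSym K)
    then obtain E where E: "E \<in> Ob L" "tag L E = IsoSym K" "r_arr L K \<in> out L X" "Cod L (r_arr L K) = E"
      using refl_sort[OF step.hyps] by blast
    note s = iso_sort[OF E(1,2)]
    have sr: "Cmp L (s_arr L K) (r_arr L K) \<in> out L X" "Cod L (Cmp L (s_arr L K) (r_arr L K)) = K"
      using comp_out[OF step.hyps E(3)] comp_arrow(3)[OF E(3)] E(4) s by auto
    show ?thesis using step.IH[OF sr(1)] sr(2) by (simp add: sort_type_refl[OF step.hyps ReflSym])
  next
    case (TransSym f)
    have A: "arr1 L f \<in> out L X" "Cod L (arr1 L f) = Dom L f"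
      using trans_sort[OF step.hyps TransSym] by metis+
    \<comment> \<open>Variable 0, put in place of the argument at \<open>f\<close>, is fixed by
      \<open>up \<sigma>\<close>, so the case distinction survives the substitution.\<close>
    have "sub (up \<sigma>) (if p = f then EVar 0 else lift (x (Cmp L p (arr1 L f)))) =
       (if p = f then EVar 0 else lift (sub \<sigma> (x (Cmp L p (arr1 L f)))))" for p
      by (simp add: sub_lift)
    then show ?thesis using step.IH[OF A(1)] A(2)
      by (simp add: sort_type_trans[OF step.hyps TransSym] sub_transport sub_lift)
  qed
qed

lemma lift_sort_type:
  "K \<in> Ob L \<Longrightarrow> lift (sort_type L c K x) = sort_type L (\<lambda>A. lift (c A)) K (\<lambda>f. lift (x f))"
  by (simp add: ren_eq_sub sub_sort_type)

section \<open>Typing of sorts, components and structures\<close>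

text \<open>The premises of the rule \<open>l_sort\<close> carried over to type theory:
  \<open>x\<close> is an instance of the telescope of arguments of \<open>K\<close>.\<close>

definition args_typed :: "hctx \<Rightarrow> ('o \<Rightarrow> exp) \<Rightarrow> 'o \<Rightarrow> ('a \<Rightarrow> exp) \<Rightarrow> bool" where
  "args_typed \<Gamma> c K x \<longleftrightarrow> (\<forall>f\<in>out L K.
     hott (HEnt \<Gamma> (HasType (x f) (sort_type L c (Cod L f) (\<lambda>p. x (Cmp L p f))))))"

definition comps_typed :: "hctx \<Rightarrow> ('o \<Rightarrow> exp) \<Rightarrow> 'o set \<Rightarrow> bool" where
  "comps_typed \<Gamma> c D \<longleftrightarrow> (\<forall>K\<in>D. hott (HEnt \<Gamma> (HasType (c K) (component_type L c K))))"

lemma comps_typed_mono: "\<lbrakk>comps_typed \<Gamma> c D; D' \<subseteq> D\<rbrakk> \<Longrightarrow> comps_typed \<Gamma> c D'"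
  by (auto simp: comps_typed_def)

text \<open>The arguments of the argument at \<open>g\<close> are those at composites with
  \<open>g\<close>; associativity matches the type that each has in the family for \<open>K\<close>
  with the one wanted in the family for \<open>Cod L g\<close>.\<close>

lemma args_typed_comp:
  assumes K: "K \<in> Ob L" and x: "args_typed \<Gamma> c K x" and g: "g \<in> out L K"
  shows "args_typed \<Gamma> c (Cod L g) (\<lambda>p. x (Cmp L p g))"
  unfolding args_typed_def
proof
  fix p assume p: "p \<in> out L (Cod L g)"
  have "hott (HEnt \<Gamma> (HasType (x (Cmp L p g)) (sort_type L c (Cod L p) (\<lambda>q. x (Cmp L q (Cmp L p g))))))"
    using x comp_out[OF K g p] comp_arrow(3)[OF g p] unfolding args_typed_def by metis
  moreover have "sort_type L c (Cod L p) (\<lambda>q. x (Cmp L q (Cmp L p g))) =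
      sort_type L c (Cod L p) (\<lambda>q. x (Cmp L (Cmp L q p) g))"
    by (rule sort_type_cong[OF Cod_Ob[OF p]]) (simp_all add: comp_assoc[OF g p])
  ultimately show "hott (HEnt \<Gamma> (HasType (x (Cmp L p g))
      (sort_type L c (Cod L p) (\<lambda>q. x (Cmp L (Cmp L q p) g)))))"
    by simp
qed

section \<open>Product telescopes and the types denoted by sorts\<close>

lemma pi_tel_cong:
  assumes "K \<in> Ob L" "out_list L K = ds @ fs" "\<And>A. A \<in> sorts_below L K \<inter> nonlogical L \<Longrightarrow> c A = c' A"
    "\<And>g. g \<in> set ds \<Longrightarrow> x g = x' g"
  shows "pi_tel L c x fs m = pi_tel L c' x' fs m"
  using assms
proof (induction fs arbitrary: ds c c' x x')
  case (Cons f fs)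
  have f: "f \<in> out L K" using out_list(3)[OF Cons.prems(1)] Cons.prems(2) by auto
  have "sort_type L c (Cod L f) (\<lambda>p. x (Cmp L p f)) = sort_type L c' (Cod L f) (\<lambda>p. x' (Cmp L p f))"
  proof (rule sort_type_cong[OF Cod_Ob[OF f]])
    show "c A = c' A" if "A \<in> support L (Cod L f)" for A
      using Cons.prems(3) support_below[OF Cons.prems(1) f] that by blast
    show "x (Cmp L p f) = x' (Cmp L p f)" if "p \<in> out L (Cod L f)" for p
      using Cons.prems(4) out_list_prefix[OF Cons.prems(1,2) that] by blast
  qed
  \<comment> \<open>The prefix grows by \<open>f\<close>, where both assignments now are the new
    variable. With the empty prefix nothing is asked of \<open>x\<close> and \<open>x'\<close>,
    which covers the initial value \<open>undefined\<close>.\<close>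
  moreover have "pi_tel L (\<lambda>K. lift (c K)) ((\<lambda>g. lift (x g))(f := EVar 0)) fs m =
      pi_tel L (\<lambda>K. lift (c' K)) ((\<lambda>g. lift (x' g))(f := EVar 0)) fs m"
    by (rule Cons.IH[of "ds @ [f]"]) (use Cons.prems in auto)
  ultimately show ?case by simp
qed simp

lemma sub_pi_tel:
  "set fs \<subseteq> out L K \<Longrightarrow>
    sub \<sigma> (pi_tel L c x fs m) = pi_tel L (\<lambda>A. sub \<sigma> (c A)) (\<lambda>f. sub \<sigma> (x f)) fs m"
proof (induction fs arbitrary: \<sigma> c x)
  case (Cons f fs)
  have "(\<lambda>g. sub (up \<sigma>) (((\<lambda>g. lift (x g))(f := EVar 0)) g)) =
      (\<lambda>g. lift (sub \<sigma> (x g)))(f := EVar 0)"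
    by (auto simp: sub_lift)
  moreover have "f \<in> out L K" using Cons.prems by simp
  ultimately show ?case using Cons by (simp add: sub_sort_type[OF Cod_Ob] sub_lift)
qed (simp add: sub_U_h)

lemma component_type_cong:
  "\<lbrakk>K \<in> Ob L; \<And>A. A \<in> sorts_below L K \<inter> nonlogical L \<Longrightarrow> c A = c' A\<rbrakk>
    \<Longrightarrow> component_type L c K = component_type L c' K"
  unfolding component_type_def by (rule pi_tel_cong[of K "[]"]) auto

lemma sub_component_type:
  assumes K: "K \<in> Ob L"
  shows "sub \<sigma> (component_type L c K) = component_type L (\<lambda>A. sub \<sigma> (c A)) K"
proof -
  \<comment> \<open>\<open>undefined\<close> is an unknown term that the substitution may change; no
    arrow is bound yet, so the telescope never reads it.\<close>
  have "pi_tel L (\<lambda>A. sub \<sigma> (c A)) (\<lambda>f. sub \<sigma> undefined) (out_list L K) m =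
      pi_tel L (\<lambda>A. sub \<sigma> (c A)) (\<lambda>f. undefined) (out_list L K) m" for m
    by (rule pi_tel_cong[OF K, of "[]"]) auto
  then show ?thesis
    using out_list(3)[OF K] by (simp add: component_type_def sub_pi_tel[of _ K])
qed

lemma comps_typed_lift:
  assumes "comps_typed \<Gamma> c D" "D \<subseteq> Ob L" "hott (HEnt \<Gamma> (IsType A))"
  shows "comps_typed (A # \<Gamma>) (\<lambda>K. lift (c K)) D"
  unfolding comps_typed_def
proof
  fix K assume K: "K \<in> D"
  then have "hott (HEnt (A # \<Gamma>) (HasType (lift (c K)) (lift (component_type L c K))))"
    using assms by (intro weaken_term) (auto simp: comps_typed_def)
  then show "hott (HEnt (A # \<Gamma>) (HasType (lift (c K)) (component_type L (\<lambda>K. lift (c K)) K)))"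
    using K assms(2) by (auto simp: ren_eq_sub sub_component_type)
qed

text \<open>Application to \<open>x f\<close> substitutes \<open>x f\<close> for the variable bound
  at \<open>f\<close>. The assignment \<open>y\<close> of the remaining telescope thus turns into
  \<open>x\<close> arrow by arrow, and \<open>ds\<close> records how far this has gone.\<close>

lemma foldl_EApp_type:
  assumes "K \<in> Ob L" "args_typed \<Gamma> c K x" "out_list L K = ds @ fs"
    "\<And>g. g \<in> set ds \<Longrightarrow> y g = x g" "hott (HEnt \<Gamma> (HasType t (pi_tel L c y fs m)))"
  shows "hott (HEnt \<Gamma> (HasType (foldl EApp t (map x fs)) (U_h m)))"
  using assms
proof (induction fs arbitrary: ds y t)
  case (Cons f fs)
  have fs: "set (f # fs) \<subseteq> out L K" using out_list(3)[OF Cons.prems(1)] Cons.prems(3) by auto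
  then have f: "f \<in> out L K" by simp
  have "sort_type L c (Cod L f) (\<lambda>p. x (Cmp L p f)) = sort_type L c (Cod L f) (\<lambda>p. y (Cmp L p f))"
    using Cons.prems(4) out_list_prefix[OF Cons.prems(1,3)]
    by (intro sort_type_cong[OF Cod_Ob[OF f]]) auto
  then have "hott (HEnt \<Gamma> (HasType (x f) (sort_type L c (Cod L f) (\<lambda>p. y (Cmp L p f)))))"
    using Cons.prems(2) f by (auto simp: args_typed_def)
  from app[OF Cons.prems(5)[unfolded pi_tel.simps] this]
  have "hott (HEnt \<Gamma> (HasType (EApp t (x f))
      (inst (pi_tel L (\<lambda>K. lift (c K)) ((\<lambda>g. lift (y g))(f := EVar 0)) fs m) (x f))))" .
  moreover have "(\<lambda>g. sub (x f \<bullet> EVar) (((\<lambda>g. lift (y g))(f := EVar 0)) g)) = y(f := x f)"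
    by auto
  ultimately have "hott (HEnt \<Gamma> (HasType (EApp t (x f)) (pi_tel L c (y(f := x f)) fs m)))"
    using fs by (simp add: inst_def sub_pi_tel[of _ K])
  then have "hott (HEnt \<Gamma> (HasType (foldl EApp (EApp t (x f)) (map x fs)) (U_h m)))"
    by (rule Cons.IH[OF Cons.prems(1,2), of "ds @ [f]", rotated 2]) (use Cons.prems(3,4) in auto)
  then show ?case by simp
qed simp

lemma sort_type_type:
  "\<lbrakk>K \<in> Ob L; hott (HCtx \<Gamma>); comps_typed \<Gamma> c (support L K); args_typed \<Gamma> c K x\<rbrakk>
    \<Longrightarrow> hott (HEnt \<Gamma> (IsType (sort_type L c K x)))"
proof (induction K arbitrary: \<Gamma> c x rule: sort_induct)
  case (step X)
  note args = step.prems(3)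
  have IH: "hott (HEnt \<Delta> (IsType (sort_type L d (Cod L f) y)))"
    if "f \<in> out L X" "hott (HCtx \<Delta>)" "comps_typed \<Delta> d (support L X)" "args_typed \<Delta> d (Cod L f) y"
    for f \<Delta> d y
    using step.IH[OF that(1,2) comps_typed_mono[OF that(3)]] support_mono[OF step.hyps that(1)] that(4)
    by blast
  have arg: "hott (HEnt \<Gamma> (HasType (x f) (sort_type L c (Cod L f) (\<lambda>p. x (Cmp L p f)))))"
    if "f \<in> out L X" for f
    using args that by (simp add: args_typed_def)
  have arg_type: "hott (HEnt \<Gamma> (IsType (sort_type L c (Cod L f) (\<lambda>p. x (Cmp L p f)))))"
    if "f \<in> out L X" for f
    using IH[OF that step.prems(1,2)] args_typed_comp[OF step.hyps args that] .
  show ?case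
  proof (cases "tag L X")
    case NonLogical
    then have "hott (HEnt \<Gamma> (HasType (c X) (component_type L c X)))"
      using step by (simp add: comps_typed_def support_def nonlogical_def)
    then have "hott (HEnt \<Gamma> (HasType (foldl EApp (c X) (map x (out_list L X))) (U_h (hlev L X))))"
      unfolding component_type_def by (intro foldl_EApp_type[OF step.hyps args, of "[]"]) auto
    then show ?thesis
      by (simp add: sort_type_nonlogical[OF step.hyps NonLogical] El_h_type step.prems(1))
  next
    case (IsoSym K)
    note s = iso_sort[OF step.hyps IsoSym]
    have "sort_type L c K (\<lambda>p. x (Cmp L p (t_arr L K))) = sort_type L c K (\<lambda>p. x (Cmp L p (s_arr L K)))"
      using s(5) Cod_Ob[OF s(1)] s(3) by (intro sort_type_cong) auto
    then show ?thesis
      using arg_type[OF s(1)] arg[OF s(1)] arg[OF s(2)] s(3,4)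
      by (simp add: sort_type_iso[OF step.hyps IsoSym] id_form)
  next
    case (ReflSym K)
    then obtain E where E: "E \<in> Ob L" "tag L E = IsoSym K" "r_arr L K \<in> out L X" "Cod L (r_arr L K) = E"
      "Cmp L (t_arr L K) (r_arr L K) = Cmp L (s_arr L K) (r_arr L K)"
      using refl_sort[OF step.hyps] by blast
    note s = iso_sort[OF E(1,2)]
    have sr: "Cmp L (s_arr L K) (r_arr L K) \<in> out L X" "Cod L (Cmp L (s_arr L K) (r_arr L K)) = K"
      using comp_out[OF step.hyps E(3)] comp_arrow(3)[OF E(3)] E(4) s by auto
    \<comment> \<open>The argument at the composite of s and r is typed with the bracketing p(sr),
      whereas \<open>sort_type\<close> uses (ps)r.\<close>
    have eq: "sort_type L c K (\<lambda>p. x (Cmp L p (Cmp L (s_arr L K) (r_arr L K)))) =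
        sort_type L c K (\<lambda>p. x (Cmp L (Cmp L p (s_arr L K)) (r_arr L K)))"
      using Cod_Ob[OF s(1)] s(1,3) E(4)
      by (intro sort_type_cong) (auto simp: comp_assoc[OF E(3)])
    \<comment> \<open>By tr = sr the two ends of the inner identity type coincide, so
      \<open>ERefl\<close> has that type too.\<close>
    show ?thesis
      using arg_type[OF E(3)] arg[OF E(3)] arg[OF sr(1)] E(4,5)
      unfolding sort_type_refl[OF step.hyps ReflSym] sort_type_iso[OF E(1,2)] sr(2) eq
      by (auto simp: sort_type_iso[OF E(1,2)] intro: id_form refl)
  next
    case (TransSym f)
    let ?A = "Dom L f" and ?K = "Cod L f" and ?f1 = "arr1 L f" and ?f2 = "arr2 L f" and ?e = "e_arr L f"
    obtain E where A: "?A \<in> Ob L" "f \<in> out L ?A" "top_level L f"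
      and E: "E \<in> Ob L" "tag L E = IsoSym ?K" "?e \<in> out L X" "Cod L ?e = E"
      and f1: "?f1 \<in> out L X" "Cod L ?f1 = ?A" and f2: "?f2 \<in> out L X" "Cod L ?f2 = ?A"
      and se: "Cmp L (s_arr L ?K) ?e = Cmp L f ?f1"
      and te: "Cmp L (t_arr L ?K) ?e = Cmp L f ?f2"
      and eq: "\<And>g. \<lbrakk>g \<in> out L ?A; g \<noteq> f\<rbrakk> \<Longrightarrow> Cmp L g ?f1 = Cmp L g ?f2"
      and eq': "\<And>q. q \<in> out L ?K \<Longrightarrow> Cmp L q (Cmp L f ?f1) = Cmp L q (Cmp L f ?f2)"
      using trans_sort[OF step.hyps TransSym] by metis
    note s = iso_sort[OF E(1,2)]
    have K: "?K \<in> Ob L" using Cod_Ob[OF A(2)] .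
    have ff1: "Cmp L f ?f1 \<in> out L X" "Cod L (Cmp L f ?f1) = ?K"
      using comp_out[OF step.hyps f1(1)] comp_arrow(3)[OF f1(1)] f1(2) A(2) by auto
    have ff2: "Cmp L f ?f2 \<in> out L X" "Cod L (Cmp L f ?f2) = ?K"
      using comp_out[OF step.hyps f2(1)] comp_arrow(3)[OF f2(1)] f2(2) A(2) by auto
    \<comment> \<open>The type over which transport takes place. The argument at the composite of
      \<open>f\<close> and \<open>?f1\<close> has it by definition, the one at the composite of
      \<open>f\<close> and \<open>?f2\<close> by \<open>eq'\<close>.\<close>
    let ?T = "sort_type L c ?K (\<lambda>p. x (Cmp L p (Cmp L f ?f1)))"
    have T: "hott (HEnt \<Gamma> (IsType ?T))" using arg_type[OF ff1(1)] ff1(2) by simp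
    have a: "hott (HEnt \<Gamma> (HasType (x (Cmp L f ?f1)) ?T))" using arg[OF ff1(1)] ff1(2) by simp
    have "sort_type L c ?K (\<lambda>p. x (Cmp L p (Cmp L f ?f2))) = ?T"
      using eq' by (intro sort_type_cong[OF K]) auto
    then have b: "hott (HEnt \<Gamma> (HasType (x (Cmp L f ?f2)) ?T))"
      using arg[OF ff2(1)] ff2(2) by simp
    \<comment> \<open>By \<open>se\<close> and \<open>te\<close> the argument at \<open>?e\<close>
      is an identification of the two endpoints in \<open>?T\<close>.\<close>
    have "sort_type L c ?K (\<lambda>p. x (Cmp L (Cmp L p (s_arr L ?K)) ?e)) = ?T"
      using s(1,3) E(4) by (intro sort_type_cong[OF K]) (auto simp: comp_assoc[OF E(3)] se)
    then have p: "hott (HEnt \<Gamma> (HasType (x ?e) (EId ?T (x (Cmp L f ?f1)) (x (Cmp L f ?f2)))))"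
      using arg[OF E(3)] by (simp add: E(4) sort_type_iso[OF E(1,2)] se te)
    let ?y = "\<lambda>p. if p = f then EVar 0 else lift (x (Cmp L p ?f1))"
    let ?c = "\<lambda>K. lift (c K)"
    let ?C = "sort_type L ?c ?A ?y"
    have C: "hott (HEnt (?T # \<Gamma>) (IsType ?C))"
    proof (rule IH[OF f1(1), unfolded f1(2)])
      show "hott (HCtx (?T # \<Gamma>))" by (rule ctx_extend[OF T])
      show "comps_typed (?T # \<Gamma>) ?c (support L X)"
        by (rule comps_typed_lift[OF step.prems(2) _ T]) (auto simp: support_def nonlogical_def)
      show "args_typed (?T # \<Gamma>) ?c ?A ?y"
        unfolding args_typed_def
      proof
        fix g assume g: "g \<in> out L ?A"
        have ne: "Cmp L p g \<noteq> f" if "p \<in> out L (Cod L g)" for p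
          by (rule top_level_comp_neq[OF A(3) g that])
        have gO: "Cod L g \<in> Ob L" by (rule Cod_Ob[OF g])
        have gf: "Cmp L g ?f1 \<in> out L X" "Cod L (Cmp L g ?f1) = Cod L g"
          using comp_out[OF step.hyps f1(1)] comp_arrow(3)[OF f1(1)] f1(2) g by auto
        \<comment> \<open>As \<open>f\<close> is not a composite, every argument keeps its old type,
          merely weakened. For \<open>g = f\<close> that type is \<open>?T\<close>, the type of the
          variable just bound.\<close>
        have y: "sort_type L ?c (Cod L g) (\<lambda>p. ?y (Cmp L p g)) =
            lift (sort_type L c (Cod L g) (\<lambda>p. x (Cmp L p (Cmp L g ?f1))))"
          unfolding lift_sort_type[OF gO] using ne f1(2) g
          by (intro sort_type_cong[OF gO]) (auto simp: comp_assoc[OF f1(1)])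
        show "hott (HEnt (?T # \<Gamma>) (HasType (?y g) (sort_type L ?c (Cod L g) (\<lambda>p. ?y (Cmp L p g)))))"
        proof (cases "g = f")
          case True
          then show ?thesis unfolding y using var_0_type[OF T] by simp
        next
          case False
          then show ?thesis unfolding y using weaken_term[OF T arg[OF gf(1)]] gf(2) by simp
        qed
      qed
    qed
    have inst_C: "inst ?C w = sort_type L c ?A (\<lambda>p. if p = f then w else x (Cmp L p ?f1))" for w
    proof -
      have "(\<lambda>p. sub (w \<bullet> EVar) (?y p)) = (\<lambda>p. if p = f then w else x (Cmp L p ?f1))" by auto
      then show ?thesis by (simp add: inst_def sub_sort_type[OF A(1)])
    qed
    have "inst ?C (x (Cmp L f ?f1)) = sort_type L c ?A (\<lambda>p. x (Cmp L p ?f1))"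
      unfolding inst_C by (intro sort_type_cong[OF A(1)]) auto
    then have u: "hott (HEnt \<Gamma> (HasType (x ?f1) (inst ?C (x (Cmp L f ?f1)))))"
      using arg[OF f1(1)] f1(2) by simp
    \<comment> \<open>At \<open>f\<close> the second endpoint is inserted, and away from
      \<open>f\<close> composites with \<open>?f1\<close> and \<open>?f2\<close> agree by
      \<open>eq\<close>. So the target of the transport is the type of the argument at
      \<open>?f2\<close>.\<close>
    have "inst ?C (x (Cmp L f ?f2)) = sort_type L c ?A (\<lambda>p. x (Cmp L p ?f2))"
      unfolding inst_C using eq by (intro sort_type_cong[OF A(1)]) auto
    with transport_type[OF T C a b p u] arg[OF f2(1)] arg_type[OF f2(1)] f2(2) show ?thesis
      by (simp add: sort_type_trans[OF step.hyps TransSym] id_form)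
  qed
qed

text \<open>The arrows in \<open>ds\<close> are bound already; the invariant is that their terms
  have the types that they prescribe for one another.\<close>

lemma pi_tel_type:
  assumes "K \<in> Ob L" "out_list L K = ds @ fs" "hott (HCtx \<Gamma>)"
    "comps_typed \<Gamma> c (sorts_below L K \<inter> nonlogical L)"
    "\<And>g. g \<in> set ds \<Longrightarrow>
      hott (HEnt \<Gamma> (HasType (x g) (sort_type L c (Cod L g) (\<lambda>p. x (Cmp L p g)))))"
  shows "hott (HEnt \<Gamma> (IsType (pi_tel L c x fs m)))"
  using assms
proof (induction fs arbitrary: ds \<Gamma> c x)
  case Nil
  then show ?case by (simp add: U_h_type)
next
  case (Cons f fs)
  note K = Cons.prems(1) and l = Cons.prems(2)
  have dso: "set ds \<subseteq> out L K" and f: "f \<in> out L K" and fds: "f \<notin> set ds"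
    using out_list(2,3)[OF K] l by auto
  have pre: "Cmp L p f \<in> set ds" if "p \<in> out L (Cod L f)" for p
    by (rule out_list_prefix[OF K l that])
  have pre': "Cmp L p g \<in> set ds" if "g \<in> set ds" "p \<in> out L (Cod L g)" for p g
  proof -
    obtain ds1 ds2 where ds: "ds = ds1 @ g # ds2" using \<open>g \<in> set ds\<close> by (meson split_list)
    with out_list_prefix[OF K _ that(2), of ds1 "ds2 @ f # fs"] l show ?thesis by simp
  qed
  let ?S = "sort_type L c (Cod L f) (\<lambda>p. x (Cmp L p f))"
  have S: "hott (HEnt \<Gamma> (IsType ?S))"
  proof (rule sort_type_type[OF Cod_Ob[OF f] Cons.prems(3)])
    show "comps_typed \<Gamma> c (support L (Cod L f))"
      by (rule comps_typed_mono[OF Cons.prems(4) support_below[OF K f]])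
    show "args_typed \<Gamma> c (Cod L f) (\<lambda>p. x (Cmp L p f))"
      unfolding args_typed_def
    proof
      fix p assume p: "p \<in> out L (Cod L f)"
      have "sort_type L c (Cod L p) (\<lambda>q. x (Cmp L q (Cmp L p f))) =
          sort_type L c (Cod L p) (\<lambda>q. x (Cmp L (Cmp L q p) f))"
        by (rule sort_type_cong[OF Cod_Ob[OF p]]) (simp_all add: comp_assoc[OF f p])
      with Cons.prems(5)[OF pre[OF p]] comp_arrow(3)[OF f p]
      show "hott (HEnt \<Gamma> (HasType (x (Cmp L p f)) (sort_type L c (Cod L p) (\<lambda>q. x (Cmp L (Cmp L q p) f)))))"
        by simp
    qed
  qed
  let ?y = "(\<lambda>g. lift (x g))(f := EVar 0)"
  have y: "hott (HEnt (?S # \<Gamma>) (HasType (?y g) (sort_type L (\<lambda>K. lift (c K)) (Cod L g) (\<lambda>p. ?y (Cmp L p g)))))"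
    if g: "g \<in> set (ds @ [f])" for g
  proof -
    have gO: "Cod L g \<in> Ob L" using g dso f Cod_Ob by auto
    \<comment> \<open>Composites with an arrow bound so far lie in \<open>ds\<close>, so they differ
      from \<open>f\<close>: the new variable occurs in none of these types, not even its
      own.\<close>
    have "Cmp L p g \<in> set ds" if "p \<in> out L (Cod L g)" for p
      using g pre[of p] pre'[of g p] that by auto
    with fds have "Cmp L p g \<noteq> f" if "p \<in> out L (Cod L g)" for p
      using that by metis
    then have "sort_type L (\<lambda>K. lift (c K)) (Cod L g) (\<lambda>p. ?y (Cmp L p g)) =
        lift (sort_type L c (Cod L g) (\<lambda>p. x (Cmp L p g)))"
      unfolding lift_sort_type[OF gO] by (intro sort_type_cong[OF gO]) auto
    moreover have "hott (HEnt (?S # \<Gamma>) (HasType (?y g) (lift (sort_type L c (Cod L g) (\<lambda>p. x (Cmp L p g))))))"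
      using var_0_type[OF S] weaken_term[OF S Cons.prems(5)] g fds by auto
    ultimately show ?thesis by simp
  qed
  have "hott (HEnt (?S # \<Gamma>) (IsType (pi_tel L (\<lambda>K. lift (c K)) ?y fs m)))"
  proof (rule Cons.IH[of "ds @ [f]"])
    show "comps_typed (?S # \<Gamma>) (\<lambda>K. lift (c K)) (sorts_below L K \<inter> nonlogical L)"
      by (rule comps_typed_lift[OF Cons.prems(4) _ S]) (auto simp: nonlogical_def)
    show "out_list L K = (ds @ [f]) @ fs" by (simp add: l)
    show "hott (HCtx (?S # \<Gamma>))" by (rule ctx_extend[OF S])
  qed (fact K y)+
  with S show ?case by (simp add: pi_form)
qed

lemma component_type_type:
  "\<lbrakk>K \<in> Ob L; hott (HCtx \<Gamma>); comps_typed \<Gamma> c (sorts_below L K \<inter> nonlogical L)\<rbrakk>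
    \<Longrightarrow> hott (HEnt \<Gamma> (IsType (component_type L c K)))"
  unfolding component_type_def by (rule pi_tel_type[of K "[]"]) auto

end

section \<open>Structures as iterated sums over the non-logical sorts\<close>

locale ess_finite_h_sig = h_sig L for L :: "('o, 'a) signature" +
  assumes ess_finite: "essentially_finite L"
begin

lemma nonlogical_list:
  "sorted_wrt (oless L) (nonlogical_list L)" "distinct (nonlogical_list L)"
  "set (nonlogical_list L) = nonlogical L" "strict_linear_on (nonlogical L) (oless L)"
proof -
  have "strict_linear_on (Ob L) (oless L)" using proper by (simp add: proper_order_def)
  then show lin: "strict_linear_on (nonlogical L) (oless L)"
    unfolding strict_linear_on_def nonlogical_def by blast
  from the_sorted_list[OF _ this] ess_finite
  show "sorted_wrt (oless L) (nonlogical_list L)" "distinct (nonlogical_list L)"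
    "set (nonlogical_list L) = nonlogical L"
    by (simp_all add: nonlogical_list_def essentially_finite_def)
qed

lemma nonlogical_list_prefix:
  assumes l: "nonlogical_list L = Ds @ K # Ks"
  shows "sorts_below L K \<inter> nonlogical L \<subseteq> set Ds"
proof
  fix A assume A: "A \<in> sorts_below L K \<inter> nonlogical L"
  have "K \<in> Ob L" using nonlogical_list(3) l by (auto simp: nonlogical_def)
  then have "oless L A K" using A oless_Cod by (auto simp: sorts_below_def)
  then show "A \<in> set Ds"
    using sorted_prefix_downward_closed[OF nonlogical_list(4), of Ds K Ks A] nonlogical_list(1,3) l A
    by simp
qed

lemma nonlogical_list_Ob: "nonlogical_list L = Ds @ Ks \<Longrightarrow> set Ds \<subseteq> Ob L \<and> set Ks \<subseteq> Ob L"
  using nonlogical_list(3) by (auto simp: nonlogical_def)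

lemma sub_struc_tel:
  "set Ks \<subseteq> Ob L \<Longrightarrow> sub \<sigma> (struc_tel L c Ks) = struc_tel L (\<lambda>A. sub \<sigma> (c A)) Ks"
proof (induction Ks arbitrary: \<sigma> c rule: induct_list012)
  case (3 K K' Ks)
  have "(\<lambda>A. sub (up \<sigma>) (((\<lambda>A. lift (c A))(K := EVar 0)) A)) = (\<lambda>A. lift (sub \<sigma> (c A)))(K := EVar 0)"
    by (auto simp: sub_lift)
  with 3 show ?case by (simp add: sub_component_type)
qed (simp_all add: sub_component_type)

lemma inst_struc_tel:
  assumes "set Ks \<subseteq> Ob L"
  shows "inst (struc_tel L ((\<lambda>A. lift (c A))(K := EVar 0)) Ks) a = struc_tel L (c(K := a)) Ks"
proof -
  have "(\<lambda>A. sub (a \<bullet> EVar) (((\<lambda>A. lift (c A))(K := EVar 0)) A)) = c(K := a)" by auto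
  then show ?thesis by (simp add: inst_def sub_struc_tel[OF assms])
qed

lemma struc_tel_cong:
  "\<lbrakk>nonlogical_list L = Ds @ Ks; \<And>A. A \<in> set Ds \<Longrightarrow> c A = c' A\<rbrakk>
    \<Longrightarrow> struc_tel L c Ks = struc_tel L c' Ks"
proof (induction Ks arbitrary: Ds c c' rule: induct_list012)
  case (2 K)
  then show ?case
    using nonlogical_list_prefix[OF 2(1)] nonlogical_list_Ob[OF 2(1)]
    by (auto intro!: component_type_cong)
next
  case (3 K K' Ks)
  have "component_type L c K = component_type L c' K"
    using 3(4) nonlogical_list_prefix[OF 3(3)] nonlogical_list_Ob[OF 3(3)]
    by (auto intro!: component_type_cong)
  moreover have "struc_tel L ((\<lambda>A. lift (c A))(K := EVar 0)) (K' # Ks) =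
      struc_tel L ((\<lambda>A. lift (c' A))(K := EVar 0)) (K' # Ks)"
    by (rule 3(2)[of "Ds @ [K]"]) (use 3(3,4) in auto)
  ultimately show ?case by simp
qed simp

text \<open>Component types look only at earlier entries of the list, so the update at
  \<open>K\<close> changes neither the types of the components in \<open>Ds\<close> nor that of
  \<open>K\<close> itself.\<close>

lemma comps_typed_extend:
  assumes c: "comps_typed \<Gamma> c (set Ds)" and l: "nonlogical_list L = Ds @ K # Ks"
    and a: "hott (HEnt \<Gamma> (HasType a (component_type L c K)))"
  shows "comps_typed \<Gamma> (c(K := a)) (set (Ds @ [K]))"
proof -
  have K: "K \<notin> set Ds" "K \<in> Ob L" using nonlogical_list(2) nonlogical_list_Ob[OF l] l by auto
  have "component_type L (c(K := a)) A = component_type L c A" if A: "A \<in> set (Ds @ [K])" for A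
  proof -
    obtain Ds1 Ds2 where "Ds @ [K] = Ds1 @ A # Ds2" "set Ds1 \<subseteq> set Ds"
    proof (cases "A = K")
      case True
      then show ?thesis using that[of Ds "[]"] by simp
    next
      case False
      with A obtain xs ys where "Ds = xs @ A # ys" by (auto dest: split_list)
      then show ?thesis using that[of xs "ys @ [K]"] by auto
    qed
    then have "nonlogical_list L = Ds1 @ A # Ds2 @ Ks" using l by (metis append.assoc append_Cons append_Nil)
    from nonlogical_list_prefix[OF this] nonlogical_list_Ob[OF this] \<open>set Ds1 \<subseteq> set Ds\<close> K
    show ?thesis by (intro component_type_cong) auto
  qed
  then show ?thesis using c a K by (auto simp: comps_typed_def)
qed

lemma struc_tel_type:
  "\<lbrakk>nonlogical_list L = Ds @ Ks; hott (HCtx \<Gamma>); comps_typed \<Gamma> c (set Ds)\<rbrakk>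
    \<Longrightarrow> hott (HEnt \<Gamma> (IsType (struc_tel L c Ks)))"
proof (induction Ks arbitrary: Ds \<Gamma> c rule: induct_list012)
  case 1
  then show ?case by (simp add: one_form)
next
  case (2 K)
  then show ?case
    using component_type_type[OF _ 2(2) comps_typed_mono[OF 2(3) nonlogical_list_prefix[OF 2(1)]]]
      nonlogical_list_Ob[OF 2(1)] by simp
next
  case (3 K K' Ks)
  note Ob = nonlogical_list_Ob[OF 3(3)]
  have T: "hott (HEnt \<Gamma> (IsType (component_type L c K)))"
    using component_type_type[OF _ 3(4) comps_typed_mono[OF 3(5) nonlogical_list_prefix[OF 3(3)]]] Ob
    by simp
  have l: "nonlogical_list L = (Ds @ [K]) @ K' # Ks" using 3(3) by simp
  have "hott (HEnt (component_type L c K # \<Gamma>) (HasType (EVar 0) (component_type L (\<lambda>A. lift (c A)) K)))"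
    using var_0_type[OF T] Ob by (simp add: ren_eq_sub sub_component_type)
  from comps_typed_extend[OF comps_typed_lift[OF 3(5) _ T] 3(3) this] Ob
  have "comps_typed (component_type L c K # \<Gamma>) ((\<lambda>A. lift (c A))(K := EVar 0)) (set (Ds @ [K]))"
    by simp
  then show ?case
    unfolding struc_tel.simps by (intro sig_form T 3(2)[OF l] ctx_extend)
qed

text \<open>The components in \<open>Ks\<close> are projections of \<open>M\<close>, those in
  \<open>Ds\<close> are taken from \<open>c\<close>. Each step of the induction moves one first
  projection into \<open>c\<close>, which is where the types of the later components look for
  it.\<close>

lemma components_typed:
  "\<lbrakk>nonlogical_list L = Ds @ Ks; hott (HCtx \<Gamma>); comps_typed \<Gamma> c (set Ds);
    hott (HEnt \<Gamma> (HasType M (struc_tel L c Ks)))\<rbrakk>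
    \<Longrightarrow> comps_typed \<Gamma> (\<lambda>A. if A \<in> set Ks then components Ks (struc_tel L c Ks) M A else c A) (set (Ds @ Ks))"
proof (induction Ks arbitrary: Ds c M rule: induct_list012)
  case 1
  then show ?case by simp
next
  case (2 K)
  have "(\<lambda>A. if A \<in> set [K] then components [K] (struc_tel L c [K]) M A else c A) = c(K := M)"
    by auto
  with comps_typed_extend[OF 2(3,1)] 2(4) show ?case by simp
next
  case (3 K K' Ks)
  note Ob = nonlogical_list_Ob[OF 3(3)]
  let ?A = "component_type L c K" and ?B = "struc_tel L ((\<lambda>A. lift (c A))(K := EVar 0)) (K' # Ks)"
  have T: "hott (HEnt \<Gamma> (IsType ?A))"
    using component_type_type[OF _ 3(4) comps_typed_mono[OF 3(5) nonlogical_list_prefix[OF 3(3)]]] Ob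
    by simp
  have l: "nonlogical_list L = (Ds @ [K]) @ K' # Ks" using 3(3) by simp
  have "hott (HEnt (?A # \<Gamma>) (HasType (EVar 0) (component_type L (\<lambda>A. lift (c A)) K)))"
    using var_0_type[OF T] Ob by (simp add: ren_eq_sub sub_component_type)
  from comps_typed_extend[OF comps_typed_lift[OF 3(5) _ T] 3(3) this] Ob
  have "comps_typed (?A # \<Gamma>) ((\<lambda>A. lift (c A))(K := EVar 0)) (set (Ds @ [K]))"
    by simp
  then have B: "hott (HEnt (?A # \<Gamma>) (IsType ?B))" by (rule struc_tel_type[OF l ctx_extend[OF T]])
  have M: "hott (HEnt \<Gamma> (HasType M (ESig ?A ?B)))" using 3(6) by simp
  let ?c = "c(K := proj1 ?A M)"
  have inst: "inst ?B (proj1 ?A M) = struc_tel L ?c (K' # Ks)"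
    using inst_struc_tel[of "K' # Ks"] Ob by simp
  have "hott (HEnt \<Gamma> (HasType (proj2 ?A ?B M) (struc_tel L ?c (K' # Ks))))"
    using proj2_type[OF T B M] unfolding inst .
  from 3(2)[OF l 3(4) comps_typed_extend[OF 3(5,3) proj1_type[OF T B M]] this]
  have "comps_typed \<Gamma> (\<lambda>A. if A \<in> set (K' # Ks)
      then components (K' # Ks) (struc_tel L ?c (K' # Ks)) (proj2 ?A ?B M) A else ?c A)
      (set (Ds @ K # K' # Ks))"
    by simp
  \<comment> \<open>By distinctness no later projection overwrites the one at \<open>K\<close>, so
    the two case distinctions agree.\<close>
  moreover have "K \<notin> set (K' # Ks)" using nonlogical_list(2) 3(3) by auto
  then have "(\<lambda>A. if A \<in> set (K' # Ks)
      then components (K' # Ks) (struc_tel L ?c (K' # Ks)) (proj2 ?A ?B M) A else ?c A) =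
    (\<lambda>A. if A \<in> set (K # K' # Ks)
      then components (K # K' # Ks) (struc_tel L c (K # K' # Ks)) M A else c A)"
    using inst by (intro ext) auto
  ultimately show ?case by simp
qed

text \<open>Confined to sorts in the list because elsewhere \<open>components\<close> is
  \<open>undefined\<close>. The recursion inspects the shape of its type argument, so the induction
  stays with types \<open>struc_tel\<close>, to which instantiating a tail leads back.\<close>

lemma sub_components:
  "\<lbrakk>set Ks \<subseteq> Ob L; A \<in> set Ks\<rbrakk> \<Longrightarrow> sub \<sigma> (components Ks (struc_tel L c Ks) M A) =
     components Ks (sub \<sigma> (struc_tel L c Ks)) (sub \<sigma> M) A"
proof (induction Ks arbitrary: c M rule: induct_list012)
  case (3 K K' Ks)
  let ?B = "struc_tel L ((\<lambda>A. lift (c A))(K := EVar 0)) (K' # Ks)"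
  have inst: "inst ?B a = struc_tel L (c(K := a)) (K' # Ks)" for a
    using inst_struc_tel[of "K' # Ks"] 3(3) by simp
  have "sub \<sigma> (components (K' # Ks) (inst ?B a) N A) =
      components (K' # Ks) (inst (sub (up \<sigma>) ?B) (sub \<sigma> a)) (sub \<sigma> N) A"
    if "A \<in> set (K' # Ks)" for a N
    using 3(2)[OF _ that] 3(3) by (simp only: inst sub_inst[symmetric] set_simps insert_subset)
  moreover have "A \<in> set (K' # Ks)" if "A \<noteq> K" using that 3(4) by auto
  ultimately show ?case by (simp add: sub_proj1 sub_proj2)
qed auto

text \<open>Closedness, phrased as invariance under all substitutions. The initial assignment
  \<open>undefined\<close> need not be invariant; \<open>struc_tel_cong\<close> with the empty
  prefix disposes of it.\<close>

lemma sub_HStruc: "sub \<sigma> (HStruc L) = HStruc L"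
proof -
  have "struc_tel L (\<lambda>_. sub \<sigma> undefined) (nonlogical_list L) =
      struc_tel L (\<lambda>_. undefined) (nonlogical_list L)"
    by (rule struc_tel_cong[of "[]"]) auto
  then show ?thesis
    using nonlogical_list_Ob[of "[]"] by (simp add: HStruc_def sub_struc_tel)
qed

lemma HStruc_type: "hott (HEnt [] (IsType (HStruc L)))"
  unfolding HStruc_def by (rule struc_tel_type[of "[]"]) (auto simp: ctx_empty comps_typed_def)

abbreviation struc_comp :: "exp \<Rightarrow> 'o \<Rightarrow> exp" where
  "struc_comp M \<equiv> components (nonlogical_list L) (HStruc L) M"

lemma sub_struc_comp: "A \<in> nonlogical L \<Longrightarrow> sub \<sigma> (struc_comp M A) = struc_comp (sub \<sigma> M) A"
  using sub_components[of "nonlogical_list L" A \<sigma> "\<lambda>_. undefined" M] nonlogical_list_Ob[of "[]"]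
    sub_HStruc nonlogical_list(3)
  by (simp add: HStruc_def)

lemma struc_comp_typed:
  assumes "hott (HCtx \<Gamma>)" "hott (HEnt \<Gamma> (HasType M (HStruc L)))"
  shows "comps_typed \<Gamma> (struc_comp M) (nonlogical L)"
proof -
  let ?c = "\<lambda>A. if A \<in> nonlogical L then struc_comp M A else undefined"
  have "comps_typed \<Gamma> ?c (nonlogical L)"
    using components_typed[of "[]" "nonlogical_list L" \<Gamma> "\<lambda>_. undefined" M, folded HStruc_def] assms
    by (simp add: nonlogical_list(3) comps_typed_def)
  moreover have "component_type L ?c K = component_type L (struc_comp M) K" if "K \<in> nonlogical L" for K
    using that by (intro component_type_cong) (auto simp: nonlogical_def)
  ultimately show ?thesis by (simp add: comps_typed_def)
qed

section \<open>Interpretation of contexts and judgements\<close>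

fun sort_ok :: "('o, 'a) sort_exp \<Rightarrow> bool" where
  "sort_ok (Sort K x) \<longleftrightarrow> K \<in> Ob L"

fun sort_vars :: "('o, 'a) sort_exp \<Rightarrow> var set" where
  "sort_vars (Sort K x) = x ` out L K"

fun formula_ok :: "('o, 'a) formula \<Rightarrow> bool" where
  "formula_ok (Conj \<phi> \<psi>) \<longleftrightarrow> formula_ok \<phi> \<and> formula_ok \<psi>"
| "formula_ok (Disj \<phi> \<psi>) \<longleftrightarrow> formula_ok \<phi> \<and> formula_ok \<psi>"
| "formula_ok (Impl \<phi> \<psi>) \<longleftrightarrow> formula_ok \<phi> \<and> formula_ok \<psi>"
| "formula_ok (Forall x S \<phi>) \<longleftrightarrow> sort_ok S \<and> formula_ok \<phi>"
| "formula_ok (Exists x S \<phi>) \<longleftrightarrow> sort_ok S \<and> formula_ok \<phi>"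
| "formula_ok _ \<longleftrightarrow> True"

fun free_vars :: "('o, 'a) formula \<Rightarrow> var set" where
  "free_vars (Conj \<phi> \<psi>) = free_vars \<phi> \<union> free_vars \<psi>"
| "free_vars (Disj \<phi> \<psi>) = free_vars \<phi> \<union> free_vars \<psi>"
| "free_vars (Impl \<phi> \<psi>) = free_vars \<phi> \<union> free_vars \<psi>"
| "free_vars (Forall x S \<phi>) = sort_vars S \<union> (free_vars \<phi> - {x})"
| "free_vars (Exists x S \<phi>) = sort_vars S \<union> (free_vars \<phi> - {x})"
| "free_vars _ = {}"

fun body_ok :: "('o, 'a) lbody \<Rightarrow> bool" where
  "body_ok (IsSort S) \<longleftrightarrow> sort_ok S"
| "body_ok (HasSort x S) \<longleftrightarrow> sort_ok S"
| "body_ok (IsFormula \<phi>) \<longleftrightarrow> formula_ok \<phi>"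

fun body_vars :: "('o, 'a) lbody \<Rightarrow> var set" where
  "body_vars (IsSort S) = sort_vars S"
| "body_vars (HasSort x S) = insert x (sort_vars S)"
| "body_vars (IsFormula \<phi>) = free_vars \<phi>"

lemma sort_ok_sort_at [simp]: "sort_ok (sort_at L K x) \<longleftrightarrow> K \<in> Ob L"
  by (simp add: sort_at_def)

lemma sort_vars_sort_at [simp]: "sort_vars (sort_at L K x) = x ` out L K"
  by (simp add: sort_at_def)

lemma interp_sort_at:
  assumes "K \<in> Ob L"
  shows "interp_sort L \<Gamma> (sort_at L K x) =
    sort_type L (struc_comp (EVar (length \<Gamma>))) K (\<lambda>f. EVar (var_index \<Gamma> (x f)))"
  unfolding sort_at_def interp_sort.simps by (rule sort_type_cong[OF assms]) auto

text \<open>The condition on lengths concerns the structure variable, whose index is the length of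
  the context. Lookups are compared only on \<open>V\<close>, since an inserted or shadowed name may
  be found elsewhere.\<close>

definition ctx_ren :: "(nat \<Rightarrow> nat) \<Rightarrow> ('o, 'a) lctx \<Rightarrow> ('o, 'a) lctx \<Rightarrow> var set \<Rightarrow> bool" where
  "ctx_ren \<rho> \<Gamma> \<Gamma>' V \<longleftrightarrow>
     length \<Gamma>' = \<rho> (length \<Gamma>) \<and> (\<forall>y\<in>V. var_index \<Gamma>' y = \<rho> (var_index \<Gamma> y))"

lemma interp_sort_ren:
  assumes "sort_ok S" "ctx_ren \<rho> \<Gamma> \<Gamma>' (sort_vars S)"
  shows "interp_sort L \<Gamma>' S = ren \<rho> (interp_sort L \<Gamma> S)"
proof (cases S)
  case (Sort K x)
  then show ?thesis using assms
    by (auto simp: ren_eq_sub sub_sort_type sub_struc_comp support_def ctx_ren_def intro!: sort_type_cong)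
qed

text \<open>The name \<open>x\<close> is exempt in the premise: after the extension it has index 0
  on both sides, whatever it denoted before. This handles bound names that reoccur in a weakened
  context.\<close>

lemma ctx_ren_Cons: "ctx_ren \<rho> \<Gamma> \<Gamma>' (V - {x}) \<Longrightarrow> ctx_ren (upr \<rho>) ((x, S) # \<Gamma>) ((x, S) # \<Gamma>') V"
  by (auto simp: ctx_ren_def)

lemma ctx_ren_mono: "\<lbrakk>ctx_ren \<rho> \<Gamma> \<Gamma>' V; W \<subseteq> V\<rbrakk> \<Longrightarrow> ctx_ren \<rho> \<Gamma> \<Gamma>' W"
  by (auto simp: ctx_ren_def)

lemma ren_upr_lift: "ren (upr \<rho>) (lift t) = lift (ren \<rho> t)"
  by (simp add: ren_ren)

lemma interp_formula_ren:
  "\<lbrakk>formula_ok \<phi>; ctx_ren \<rho> \<Gamma> \<Gamma>' (free_vars \<phi>)\<rbrakk>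
    \<Longrightarrow> interp_formula L \<Gamma>' \<phi> = ren \<rho> (interp_formula L \<Gamma> \<phi>)"
proof (induction \<phi> arbitrary: \<rho> \<Gamma> \<Gamma>')
  case (Forall x S \<phi>)
  then show ?case
    using Forall.IH[OF _ ctx_ren_Cons[OF ctx_ren_mono]] interp_sort_ren[OF _ ctx_ren_mono]
    by simp
next
  case (Exists x S \<phi>)
  then show ?case
    using Exists.IH[OF _ ctx_ren_Cons[OF ctx_ren_mono]] interp_sort_ren[OF _ ctx_ren_mono]
    by simp
next
  case (Conj \<phi> \<psi>)
  then have "interp_formula L \<Gamma>' \<phi> = ren \<rho> (interp_formula L \<Gamma> \<phi>)"
    "interp_formula L \<Gamma>' \<psi> = ren \<rho> (interp_formula L \<Gamma> \<psi>)"
    by (simp_all add: ctx_ren_def ball_Un)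
  then show ?case by (simp add: ETimes_def ren_upr_lift)
next
  case (Impl \<phi> \<psi>)
  then have "interp_formula L \<Gamma>' \<phi> = ren \<rho> (interp_formula L \<Gamma> \<phi>)"
    "interp_formula L \<Gamma>' \<psi> = ren \<rho> (interp_formula L \<Gamma> \<psi>)"
    by (simp_all add: ctx_ren_def ball_Un)
  then show ?case by (simp add: EArr_def ren_upr_lift)
qed (simp_all add: ctx_ren_def ball_Un)

lemma interp_body_ren:
  assumes "body_ok J" "ctx_ren \<rho> \<Gamma> \<Gamma>' (body_vars J)"
  shows "interp_body L \<Gamma>' J = bsub (\<lambda>n. EVar (\<rho> n)) (interp_body L \<Gamma> J)"
proof (cases J)
  case (HasSort x S)
  then have "interp_sort L \<Gamma>' S = ren \<rho> (interp_sort L \<Gamma> S)"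
    using interp_sort_ren[OF _ ctx_ren_mono[OF assms(2)], of S] assms(1) by auto
  then show ?thesis using HasSort assms(2) by (simp add: ctx_ren_def ren_eq_sub)
qed (use assms interp_sort_ren interp_formula_ren in \<open>simp_all add: ren_eq_sub\<close>)

section \<open>Well-formed contexts and weakening\<close>

lemma length_interp_ctx [simp]: "length (interp_ctx L \<Gamma>) = Suc (length \<Gamma>)"
  by (induction L \<Gamma> rule: interp_ctx.induct) auto

lemma funpow_upr_Suc: "(upr ^^ k) Suc (k + n) = Suc (k + n)"
  by (induction k) simp_all

lemma ctx_ren_insert:
  "x \<notin> V \<Longrightarrow> ctx_ren ((upr ^^ length \<Delta>) Suc) (\<Delta> @ \<Gamma>) (\<Delta> @ (x, S) # \<Gamma>) V"
  by (induction \<Delta> arbitrary: V) (auto simp: ctx_ren_def funpow_upr_Suc)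

lemma ctx_ren_append:
  "fst ` set \<Delta> \<inter> V = {} \<Longrightarrow> ctx_ren (\<lambda>n. n + length \<Delta>) \<Gamma> (\<Delta> @ \<Gamma>) V"
  by (induction \<Delta>) (auto simp: ctx_ren_def)

text \<open>The invariant of the induction on derivations. It stores the formation of every entry
  instead of recovering it from \<open>HCtx\<close> by inversion; freshness and scoping keep lookup
  by name stable when a variable is inserted.\<close>

fun good_ctx :: "('o, 'a) lctx \<Rightarrow> bool" where
  "good_ctx [] \<longleftrightarrow> True"
| "good_ctx ((x, S) # \<Gamma>) \<longleftrightarrow> x \<notin> fst ` set \<Gamma> \<and> sort_ok S \<and> sort_vars S \<subseteq> fst ` set \<Gamma> \<and>
     hott (HEnt (interp_ctx L \<Gamma>) (IsType (interp_sort L \<Gamma> S))) \<and> good_ctx \<Gamma>"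

lemma good_ctx_append: "good_ctx (\<Delta> @ \<Gamma>) \<Longrightarrow> good_ctx \<Gamma>"
  by (induction \<Delta>) auto

lemma good_ctx_distinct: "good_ctx \<Gamma> \<Longrightarrow> distinct (map fst \<Gamma>)"
  by (induction \<Gamma> rule: good_ctx.induct) simp_all

lemma good_ctx_interp: "good_ctx \<Gamma> \<Longrightarrow> hott (HCtx (interp_ctx L \<Gamma>))"
  using ctx_extend[OF HStruc_type] by (cases \<Gamma>) (auto intro: ctx_extend)

fun interp_tel :: "('o, 'a) lctx \<Rightarrow> ('o, 'a) lctx \<Rightarrow> hctx" where
  "interp_tel \<Gamma> [] = []"
| "interp_tel \<Gamma> ((x, S) # \<Delta>) = interp_sort L (\<Delta> @ \<Gamma>) S # interp_tel \<Gamma> \<Delta>"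

lemma length_interp_tel [simp]: "length (interp_tel \<Gamma> \<Delta>) = length \<Delta>"
  by (induction \<Delta>) auto

lemma interp_ctx_append: "interp_ctx L (\<Delta> @ \<Gamma>) = interp_tel \<Gamma> \<Delta> @ interp_ctx L \<Gamma>"
  by (induction \<Delta>) auto

lemma interp_tel_insert:
  "\<lbrakk>good_ctx (\<Delta> @ \<Gamma>); x \<notin> fst ` set (\<Delta> @ \<Gamma>)\<rbrakk>
    \<Longrightarrow> interp_tel ((x, S) # \<Gamma>) \<Delta> = tsub (\<lambda>n. EVar (Suc n)) (interp_tel \<Gamma> \<Delta>)"
proof (induction \<Delta>)
  case (Cons a \<Delta>)
  obtain y T where a: "a = (y, T)" by force
  have "x \<notin> sort_vars T" "sort_ok T" using Cons.prems a by auto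
  then have "interp_sort L (\<Delta> @ (x, S) # \<Gamma>) T = ren ((upr ^^ length \<Delta>) Suc) (interp_sort L (\<Delta> @ \<Gamma>) T)"
    by (intro interp_sort_ren ctx_ren_insert)
  with Cons a show ?case by (simp add: ren_eq_sub up_funpow_EVar)
qed simp

lemma interp_weaken:
  assumes "good_ctx (\<Delta> @ \<Gamma>)" "x \<notin> fst ` set (\<Delta> @ \<Gamma>)" "body_ok J" "body_vars J \<subseteq> fst ` set (\<Delta> @ \<Gamma>)"
    and S: "hott (HEnt (interp_ctx L \<Gamma>) (IsType (interp_sort L \<Gamma> S)))"
    and J: "hott (HEnt (interp_ctx L (\<Delta> @ \<Gamma>)) (interp_body L (\<Delta> @ \<Gamma>) J))"
  shows "hott (HEnt (interp_ctx L (\<Delta> @ (x, S) # \<Gamma>)) (interp_body L (\<Delta> @ (x, S) # \<Gamma>) J))"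
proof -
  have "interp_body L (\<Delta> @ (x, S) # \<Gamma>) J =
      bsub (\<lambda>n. EVar ((upr ^^ length \<Delta>) Suc n)) (interp_body L (\<Delta> @ \<Gamma>) J)"
    by (rule interp_body_ren[OF assms(3) ctx_ren_insert]) (use assms(2,4) in blast)
  with weaken[OF S J[unfolded interp_ctx_append]] show ?thesis
    by (simp add: interp_ctx_append interp_tel_insert[OF assms(1,2)] up_funpow_EVar)
qed

text \<open>Each entry of \<open>\<Delta>\<close> is itself a type formed in the context behind it,
  so it is moved along by \<open>interp_weaken\<close> applied to \<open>IsSort\<close>.\<close>

lemma good_ctx_insert:
  assumes "good_ctx (\<Delta> @ \<Gamma>)" "good_ctx ((x, S) # \<Gamma>)" "x \<notin> fst ` set (\<Delta> @ \<Gamma>)"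
  shows "good_ctx (\<Delta> @ (x, S) # \<Gamma>)"
  using assms
proof (induction \<Delta>)
  case (Cons a \<Delta>)
  obtain y T where a: "a = (y, T)" by force
  have "hott (HEnt (interp_ctx L (\<Delta> @ (x, S) # \<Gamma>)) (interp_body L (\<Delta> @ (x, S) # \<Gamma>) (IsSort T)))"
    by (rule interp_weaken) (use Cons.prems a in auto)
  with Cons a show ?case by auto
qed simp

section \<open>The variable rule and the induction on derivations\<close>

lemma interp_var:
  assumes "good_ctx (\<Delta> @ (x, S) # \<Gamma>)"
  defines "\<Gamma>' \<equiv> \<Delta> @ (x, S) # \<Gamma>"
  shows "hott (HEnt (interp_ctx L \<Gamma>') (HasType (EVar (var_index \<Gamma>' x)) (interp_sort L \<Gamma>' S)))"
proof -
  have S: "sort_ok S" "sort_vars S \<subseteq> fst ` set \<Gamma>"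
    using good_ctx_append[OF assms(1)] by auto
  have disj: "fst ` set \<Delta> \<inter> insert x (fst ` set \<Gamma>) = {}"
    using good_ctx_distinct[OF assms(1)] by auto
  have xG: "x \<notin> fst ` set \<Gamma>" using good_ctx_append[OF assms(1)] by auto
  have x: "var_index \<Gamma>' x = length \<Delta>"
    using ctx_ren_append[of \<Delta> "{x}" "(x, S) # \<Gamma>"] disj by (simp add: ctx_ren_def \<Gamma>'_def)
  \<comment> \<open>The sort mentions only variables of \<open>\<Gamma>\<close>, none shadowed by
    \<open>x\<close> or \<open>\<Delta>\<close>. Passing these \<open>Suc (length \<Delta>)\<close>
    entries is the shift that the rule \<open>var\<close> makes.\<close>
  have "ctx_ren (\<lambda>n. n + Suc (length \<Delta>)) \<Gamma> \<Gamma>' (sort_vars S)"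
  proof -
    have "fst ` set (\<Delta> @ [(x, S)]) \<inter> sort_vars S = {}" using disj S(2) xG by auto
    from ctx_ren_append[OF this, of \<Gamma>] show ?thesis by (simp add: \<Gamma>'_def)
  qed
  then have "interp_sort L \<Gamma>' S = ren (\<lambda>n. n + Suc (length \<Delta>)) (interp_sort L \<Gamma> S)"
    using S by (intro interp_sort_ren)
  moreover have "interp_ctx L \<Gamma>' ! length \<Delta> = interp_sort L \<Gamma> S"
    by (simp add: \<Gamma>'_def interp_ctx_append nth_append)
  ultimately show ?thesis
    using var[OF good_ctx_interp[OF assms(1)], of "length \<Delta>", folded \<Gamma>'_def]
    by (simp add: x) (simp add: \<Gamma>'_def)
qed

lemma struc_var_typed:
  assumes "good_ctx \<Gamma>"
  shows "comps_typed (interp_ctx L \<Gamma>) (struc_comp (EVar (length \<Gamma>))) (nonlogical L)"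
proof (rule struc_comp_typed)
  show ctx: "hott (HCtx (interp_ctx L \<Gamma>))" by (rule good_ctx_interp[OF assms])
  \<comment> \<open>The structure is the outermost variable; its type is closed, hence unaffected by
    the shift in \<open>var\<close>.\<close>
  have "interp_ctx L \<Gamma> ! length \<Gamma> = HStruc L"
    using interp_ctx_append[of \<Gamma> "[]"] by (simp add: nth_append)
  with var[OF ctx, of "length \<Gamma>"]
  show "hott (HEnt (interp_ctx L \<Gamma>) (HasType (EVar (length \<Gamma>)) (HStruc L)))"
    by (simp add: ren_eq_sub sub_HStruc)
qed

text \<open>Strengthened for two reasons: weakening needs the free variables in scope, and the
  quantifier rules have only the extended context in their premise, from whose
  \<open>good_ctx\<close> the formation of the bounding sort is recovered.\<close>

lemma interp_derivable:
  "ltt L S \<Longrightarrow> hott (interp L S) \<and> (case S of LCtx \<Gamma> \<Rightarrow> good_ctx \<Gamma>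
     | LEnt \<Gamma> J \<Rightarrow> good_ctx \<Gamma> \<and> body_ok J \<and> body_vars J \<subseteq> fst ` set \<Gamma>)"
proof (induction rule: ltt.induct)
  case l_empty
  then show ?case using good_ctx_interp[of "[]"] by simp
next
  case (l_extend \<Gamma> S x)
  then have "good_ctx ((x, S) # \<Gamma>)" by simp
  then show ?case using good_ctx_interp by fastforce
next
  case (l_weaken \<Delta> \<Gamma> J S x)
  then have "good_ctx ((x, S) # \<Gamma>)" by (simp add: image_Un)
  with l_weaken show ?case
    using good_ctx_insert[of \<Delta> \<Gamma> x S] interp_weaken[of \<Delta> \<Gamma> x J S] by auto
next
  case (l_var \<Delta> x S \<Gamma>)
  then have "good_ctx (\<Delta> @ (x, S) # \<Gamma>)" by simp
  with interp_var[OF this] good_ctx_append[OF this] show ?case by auto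
next
  case (l_sort K \<Gamma> x)
  let ?c = "struc_comp (EVar (length \<Gamma>))" and ?x = "\<lambda>f. EVar (var_index \<Gamma> (x f))"
  have good: "good_ctx \<Gamma>" using l_sort by simp
  have "args_typed (interp_ctx L \<Gamma>) ?c K ?x"
    unfolding args_typed_def using l_sort.IH by (auto simp: interp_sort_at[OF Cod_Ob])
  moreover have "comps_typed (interp_ctx L \<Gamma>) ?c (support L K)"
    by (rule comps_typed_mono[OF struc_var_typed[OF good]]) (simp add: support_def)
  ultimately have "hott (HEnt (interp_ctx L \<Gamma>) (IsType (sort_type L ?c K ?x)))"
    using sort_type_type[OF \<open>K \<in> Ob L\<close> good_ctx_interp[OF good]] by blast
  then show ?case using l_sort good by (auto simp: interp_sort_at)
next
  case (l_forall x S \<Gamma> \<phi>)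
  then show ?case by (auto intro: pi_form)
next
  case (l_exists x S \<Gamma> \<phi>)
  then show ?case by (auto intro: trunc_form sig_form)
qed (auto simp: ETimes_def EArr_def
      intro: zero_form one_form sig_form trunc_form sum_form pi_form weaken_type)

end

theorem theorem4p26:
  fixes L :: "('o, 'a) signature" and S :: "('o, 'a) ljudgement"
  assumes "FOL_iso_signature L" and "essentially_finite L"
    and "ltt L S"
  shows "hott (interp L S)"
proof -
  interpret ess_finite_h_sig L
    using assms(1,2) by unfold_locales (simp_all add: FOL_iso_signature_def)
  show ?thesis using interp_derivable[OF assms(3)] by simp
qed

end
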